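(* Suppose that $\mathfrak{G}$ is a minimal groupoid of germs (an étale groupoid whose unit space is homeomorphic to the Cantor set). Then every non-trivial subgroup of $\mathsf{F}(\mathfrak{G})$ normalized by $\mathsf{A}(\mathfrak{G})$ contains $\mathsf{A}(\mathfrak{G})$. In particular, $\mathsf{A}(\mathfrak{G})$ is simple and is contained in every non-trivial normal subgroup of $\mathsf{F}(\mathfrak{G})$.
   Context: A groupoid $\mathfrak{G}$ is a small category in which every morphism is invertible, identified with its set of morphisms; $\mathsf{s}(\gamma)=\gamma^{-1}\gamma$ and $\mathsf{r}(\gamma)=\gamma\gamma^{-1}$ are the source and range, $\gamma_1\gamma_2$ is defined iff $\mathsf{s}(\gamma_1)=\mathsf{r}(\gamma_2)$, and $\mathfrak{G}^{(0)}$ is the set of units (elements $\gamma\gamma^{-1}$). A topological groupoid is a groupoid with a topology for which multiplication and inversion are continuous (not assumed Hausdorff). A bisection is a compact open subset $F\subset\mathfrak{G}$ such that $\mathsf{s}:F\to\mathsf{s}(F)$ and $\mathsf{r}:F\to\mathsf{r}(F)$ are homeomorphisms onto open subsets of $\mathfrak{G}^{(0)}$. $\mathfrak{G}$ is étale if bisections form a basis of its topology. Throughout, groupoids are étale and $\mathfrak{G}^{(0)}$ is homeomorphic to the Cantor set. Subsets are multiplied by $AB=\{ab: a\in A, b\in B, ab \text{ defined}\}$, and $A^{-1}=\{a^{-1}:a\in A\}$. The $\mathfrak{G}$-orbit of a unit $x$ is $\{\mathsf{r}(\gamma):\mathsf{s}(\gamma)=x\}$. $\mathfrak{G}$ is minimal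 if all its orbits are dense in $\mathfrak{G}^{(0)}$. $\mathfrak{G}$ is a groupoid of germs (effective) if for every non-unit $\gamma\in\mathfrak{G}$ and every bisection $F\ni\gamma$ there exists $\delta\in F$ with $\mathsf{s}(\delta)\neq\mathsf{r}(\delta)$. The topological full group $\mathsf{F}(\mathfrak{G})$ is the group, under multiplication of subsets, of all bisections $F$ with $\mathsf{s}(F)=\mathsf{r}(F)=\mathfrak{G}^{(0)}$. A multisection of degree $d$ is a collection $\mathcal{F}=\{F_{i,j}\}_{i,j=1}^d$ of $d^2$ bisections such that $F_{i_2,i_3}F_{i_1,i_2}=F_{i_1,i_3}$ for all $i_1,i_2,i_3$ and the $F_{i,i}$ are pairwise disjoint subsets of $\mathfrak{G}^{(0)}$. Its domain is $U=\bigcup_i F_{i,i}$. For a permutation $\pi$ of $\{1,\dots,d\}$ put $\mathcal{F}_\pi=\bigcup_{i=1}^d F_{i,\pi(i)}\cup(\mathfrak{G}^{(0)}\setminus U)\in\mathsf{F}(\mathfrak{G})$, and let $\mathsf{A}(\mathcal{F})=\{\mathcal{F}_\pi:\pi\text{ even}\}$. The group $\mathsf{A}(\mathfrak{G})$ is the subgroup of $\mathsf{F}(\mathfrak{G})$ generated by the union of $\mathsf{A}(\mathcal{F})$ over all multisections $\mathcal{F}$ of degree $3$. *)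

theory Defs
  imports
    "HOL-Algebra.Generated_Groups"
    "HOL-Combinatorics.Permutations"
    "HOL-Analysis.Analysis"
begin

section \<open>Topological groupoids\<close>

text \<open>A small category is identified with its set of morphisms, here the space of the topology
  \<open>gtop\<close>; objects are identified with their identity morphisms, so \<open>src\<close> and \<open>rng\<close> are again
  morphisms. The composition \<open>gmult\<close> is partial: its values count only on pairs with
  \<open>src a = rng b\<close>.\<close>

record 'a top_groupoid =
  gtop :: "'a topology"
  src :: "'a \<Rightarrow> 'a"
  rng :: "'a \<Rightarrow> 'a"
  gmult :: "'a \<Rightarrow> 'a \<Rightarrow> 'a"

abbreviation arrows :: "('a, 'm) top_groupoid_scheme \<Rightarrow> 'a set" where
  "arrows \<G> \<equiv> topspace (gtop \<G>)"

definition is_ginv :: "('a, 'm) top_groupoid_scheme \<Rightarrow> 'a \<Rightarrow> 'a \<Rightarrow> bool" where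
  "is_ginv \<G> a b \<longleftrightarrow> b \<in> arrows \<G> \<and> src \<G> b = rng \<G> a \<and> rng \<G> b = src \<G> a \<and>
     gmult \<G> b a = src \<G> a \<and> gmult \<G> a b = rng \<G> a"

definition ginv :: "('a, 'm) top_groupoid_scheme \<Rightarrow> 'a \<Rightarrow> 'a" where
  "ginv \<G> a = (THE b. is_ginv \<G> a b)"

definition units :: "('a, 'm) top_groupoid_scheme \<Rightarrow> 'a set" where
  "units \<G> = {gmult \<G> a (ginv \<G> a) | a. a \<in> arrows \<G>}"

locale groupoid =
  fixes \<G> :: "('a, 'm) top_groupoid_scheme"
  assumes src_closed: "a \<in> arrows \<G> \<Longrightarrow> src \<G> a \<in> arrows \<G>"
    and rng_closed: "a \<in> arrows \<G> \<Longrightarrow> rng \<G> a \<in> arrows \<G>"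
    and src_src: "a \<in> arrows \<G> \<Longrightarrow> src \<G> (src \<G> a) = src \<G> a"
    and rng_src: "a \<in> arrows \<G> \<Longrightarrow> rng \<G> (src \<G> a) = src \<G> a"
    and src_rng: "a \<in> arrows \<G> \<Longrightarrow> src \<G> (rng \<G> a) = rng \<G> a"
    and rng_rng: "a \<in> arrows \<G> \<Longrightarrow> rng \<G> (rng \<G> a) = rng \<G> a"
    and gmult_closed: "\<lbrakk>a \<in> arrows \<G>; b \<in> arrows \<G>; src \<G> a = rng \<G> b\<rbrakk>
      \<Longrightarrow> gmult \<G> a b \<in> arrows \<G>"
    and src_gmult: "\<lbrakk>a \<in> arrows \<G>; b \<in> arrows \<G>; src \<G> a = rng \<G> b\<rbrakk>
      \<Longrightarrow> src \<G> (gmult \<G> a b) = src \<G> b"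
    and rng_gmult: "\<lbrakk>a \<in> arrows \<G>; b \<in> arrows \<G>; src \<G> a = rng \<G> b\<rbrakk>
      \<Longrightarrow> rng \<G> (gmult \<G> a b) = rng \<G> a"
    and gmult_assoc: "\<lbrakk>a \<in> arrows \<G>; b \<in> arrows \<G>; c \<in> arrows \<G>;
        src \<G> a = rng \<G> b; src \<G> b = rng \<G> c\<rbrakk>
      \<Longrightarrow> gmult \<G> (gmult \<G> a b) c = gmult \<G> a (gmult \<G> b c)"
    and gmult_src: "a \<in> arrows \<G> \<Longrightarrow> gmult \<G> a (src \<G> a) = a"
    and rng_gmult_left: "a \<in> arrows \<G> \<Longrightarrow> gmult \<G> (rng \<G> a) a = a"
    and invertible: "a \<in> arrows \<G> \<Longrightarrow> \<exists>b. is_ginv \<G> a b"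
begin

lemma is_ginv_unique:
  assumes "a \<in> arrows \<G>" "is_ginv \<G> a b" "is_ginv \<G> a c"
  shows "b = c"
proof -
  have "b = gmult \<G> b (gmult \<G> a c)"
    using assms gmult_src[of b] by (simp add: is_ginv_def)
  also have "\<dots> = gmult \<G> (gmult \<G> b a) c"
    using assms unfolding is_ginv_def by (metis gmult_assoc)
  also have "\<dots> = c"
    using assms rng_gmult_left[of c] by (simp add: is_ginv_def)
  finally show ?thesis .
qed

lemma is_ginv_ginv: "a \<in> arrows \<G> \<Longrightarrow> is_ginv \<G> a (ginv \<G> a)"
  unfolding ginv_def using invertible is_ginv_unique by (metis theI)

lemma src_eq: "a \<in> arrows \<G> \<Longrightarrow> src \<G> a = gmult \<G> (ginv \<G> a) a"
  and rng_eq: "a \<in> arrows \<G> \<Longrightarrow> rng \<G> a = gmult \<G> a (ginv \<G> a)"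
  using is_ginv_ginv by (simp_all add: is_ginv_def)

lemma units_eq: "units \<G> = rng \<G> ` arrows \<G>"
  unfolding units_def using rng_eq by auto

end

locale topological_groupoid = groupoid +
  assumes continuous_gmult:
    "continuous_map
       (subtopology (prod_topology (gtop \<G>) (gtop \<G>)) {(a, b). src \<G> a = rng \<G> b})
       (gtop \<G>) (\<lambda>(a, b). gmult \<G> a b)"
    and continuous_ginv: "continuous_map (gtop \<G>) (gtop \<G>) (ginv \<G>)"

abbreviation unit_space :: "('a, 'm) top_groupoid_scheme \<Rightarrow> 'a topology" where
  "unit_space \<G> \<equiv> subtopology (gtop \<G>) (units \<G>)"

definition bisection :: "('a, 'm) top_groupoid_scheme \<Rightarrow> 'a set \<Rightarrow> bool" where
  "bisection \<G> F \<longleftrightarrow> compactin (gtop \<G>) F \<and> openin (gtop \<G>) F \<and>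
     openin (unit_space \<G>) (src \<G> ` F) \<and>
     homeomorphic_map (subtopology (gtop \<G>) F) (subtopology (unit_space \<G>) (src \<G> ` F)) (src \<G>) \<and>
     openin (unit_space \<G>) (rng \<G> ` F) \<and>
     homeomorphic_map (subtopology (gtop \<G>) F) (subtopology (unit_space \<G>) (rng \<G> ` F)) (rng \<G>)"

locale etale_groupoid = topological_groupoid +
  assumes bisection_basis: "openin (gtop \<G>) = arbitrary union_of (bisection \<G>)"

definition cantor_space :: "(nat \<Rightarrow> bool) topology" where
  "cantor_space = product_topology (\<lambda>_. discrete_topology UNIV) UNIV"

definition orbit_of :: "('a, 'm) top_groupoid_scheme \<Rightarrow> 'a \<Rightarrow> 'a set" where
  "orbit_of \<G> x = {rng \<G> a | a. a \<in> arrows \<G> \<and> src \<G> a = x}"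

definition minimal_groupoid :: "('a, 'm) top_groupoid_scheme \<Rightarrow> bool" where
  "minimal_groupoid \<G> \<longleftrightarrow>
     (\<forall>x \<in> units \<G>. Abstract_Topology.closure_of (unit_space \<G>) (orbit_of \<G> x) = units \<G>)"

definition groupoid_of_germs :: "('a, 'm) top_groupoid_scheme \<Rightarrow> bool" where
  "groupoid_of_germs \<G> \<longleftrightarrow>
     (\<forall>a \<in> arrows \<G> - units \<G>. \<forall>F. bisection \<G> F \<and> a \<in> F \<longrightarrow>
        (\<exists>b \<in> F. src \<G> b \<noteq> rng \<G> b))"

section \<open>Full groups\<close>

definition set_gmult :: "('a, 'm) top_groupoid_scheme \<Rightarrow> 'a set \<Rightarrow> 'a set \<Rightarrow> 'a set" where
  "set_gmult \<G> A B = {gmult \<G> a b | a b. a \<in> A \<and> b \<in> B \<and> src \<G> a = rng \<G> b}"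

definition full_group :: "('a, 'm) top_groupoid_scheme \<Rightarrow> 'a set monoid" where
  "full_group \<G> =
     \<lparr>carrier = {F. bisection \<G> F \<and> src \<G> ` F = units \<G> \<and> rng \<G> ` F = units \<G>},
      monoid.mult = set_gmult \<G>,
      monoid.one = units \<G>\<rparr>"

text \<open>Only the entries \<open>F i j\<close> with \<open>i, j \<in> {1..d}\<close> are part of the multisection; \<open>F i j\<close> has
  source \<open>F i i\<close> and range \<open>F j j\<close>.\<close>

definition multisection ::
    "('a, 'm) top_groupoid_scheme \<Rightarrow> nat \<Rightarrow> (nat \<Rightarrow> nat \<Rightarrow> 'a set) \<Rightarrow> bool" where
  "multisection \<G> d F \<longleftrightarrow>
     (\<forall>i \<in> {1..d}. \<forall>j \<in> {1..d}. bisection \<G> (F i j)) \<and>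
     (\<forall>i \<in> {1..d}. \<forall>j \<in> {1..d}. \<forall>k \<in> {1..d}. set_gmult \<G> (F j k) (F i j) = F i k) \<and>
     (\<forall>i \<in> {1..d}. F i i \<subseteq> units \<G>) \<and>
     (\<forall>i \<in> {1..d}. \<forall>j \<in> {1..d}. i \<noteq> j \<longrightarrow> F i i \<inter> F j j = {})"

definition multisection_perm ::
    "('a, 'm) top_groupoid_scheme \<Rightarrow> nat \<Rightarrow> (nat \<Rightarrow> nat \<Rightarrow> 'a set) \<Rightarrow> (nat \<Rightarrow> nat) \<Rightarrow> 'a set" where
  "multisection_perm \<G> d F \<pi> =
     (\<Union>i \<in> {1..d}. F i (\<pi> i)) \<union> (units \<G> - (\<Union>i \<in> {1..d}. F i i))"

definition multisection_alt ::
    "('a, 'm) top_groupoid_scheme \<Rightarrow> nat \<Rightarrow> (nat \<Rightarrow> nat \<Rightarrow> 'a set) \<Rightarrow> 'a set set" where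
  "multisection_alt \<G> d F = {multisection_perm \<G> d F \<pi> | \<pi>. \<pi> permutes {1..d} \<and> evenperm \<pi>}"

definition alternating_full_group :: "('a, 'm) top_groupoid_scheme \<Rightarrow> 'a set set" where
  "alternating_full_group \<G> =
     generate (full_group \<G>) (\<Union>F \<in> {F. multisection \<G> 3 F}. multisection_alt \<G> 3 F)"

definition normalized_by :: "('g, 'm) monoid_scheme \<Rightarrow> 'g set \<Rightarrow> 'g set \<Rightarrow> bool" where
  "normalized_by K H A \<longleftrightarrow> (\<forall>a \<in> A. (a <#\<^bsub>K\<^esub> H) #>\<^bsub>K\<^esub> inv\<^bsub>K\<^esub> a = H)"

text \<open>The locale \<open>simple_group\<close> of HOL-Algebra requires \<open>order G > 1\<close>; as \<open>order\<close> is \<open>0\<close> on infinite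
  groups, it covers finite groups only.\<close>

definition is_simple_group :: "('g, 'm) monoid_scheme \<Rightarrow> bool" where
  "is_simple_group K \<longleftrightarrow> group K \<and> carrier K \<noteq> {\<one>\<^bsub>K\<^esub>} \<and>
     (\<forall>N. N \<lhd> K \<longrightarrow> N = {\<one>\<^bsub>K\<^esub>} \<or> N = carrier K)"

end

theory Submission
  imports Defs
begin

text \<open>Effectiveness makes the action of the full group on the unit space faithful, so identities between
  its elements can be checked pointwise. A non-trivial \<open>h\<close> in a normalized subgroup \<open>H\<close> displaces
  some non-empty open set \<open>U\<close>, and then \<open>[[a\<^sup>-\<^sup>1, h], b] = [a\<^sup>-\<^sup>1, b]\<close> for \<open>a, b\<close> in the alternating full group
  supported in \<open>U\<close>. Hence \<open>H\<close> contains the 3-cycles on sufficiently small bisections inside \<open>U\<close>,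
  because a 3-cycle is a commutator of two 3-cycles sharing one point. By minimality every orbit has
  infinitely many points in \<open>U\<close>, so near each point any given 3-cycle is conjugate, by a product of
  3-cycles, to one inside \<open>U\<close>. Compactness patches these local pieces together.\<close>

section \<open>Bisections of etale groupoids\<close>

text \<open>\<open>H\<close> is normalized by the alternating full group only, so every conjugation
  has to use its elements. This explains the eight indices of the local argument: two 3-cycles
  inside \<open>U\<close> with exactly one common point occupy five units, their commutator is a
  3-cycle on three of these, and one of the two left over serves as the third point of each 3-cycle
  that carries a given unit into \<open>U\<close>; together with the three given units this makes
  eight. Relations between such elements are checked on indices: a family of bisections with one
  common source set parametrizes the permuted units, and a product over a common family is a
  composition of permutations. The arrow space may fail to be Hausdorff, so the criteria for
  bisections test compactness and closedness on source sets, in the unit space. The cover used in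
  the patching is not disjoint; the local statement is therefore made for every clopen subset of a
  neighbourhood, so that a 3-cycle over \<open>V\<close> can be split over
  \<open>V \<inter> S\<close> and \<open>V - S\<close>.\<close>

context groupoid
begin

lemma units_subset: "units \<G> \<subseteq> arrows \<G>"
  using units_eq rng_closed by auto

lemma src_unit: "x \<in> units \<G> \<Longrightarrow> src \<G> x = x"
  and rng_unit: "x \<in> units \<G> \<Longrightarrow> rng \<G> x = x"
  using units_eq src_rng rng_rng by auto

lemma rng_in_units: "a \<in> arrows \<G> \<Longrightarrow> rng \<G> a \<in> units \<G>"
  using units_eq by auto

lemma src_in_units: "a \<in> arrows \<G> \<Longrightarrow> src \<G> a \<in> units \<G>"
  using units_eq src_closed rng_src by (metis image_eqI)

lemma ginv_closed: "a \<in> arrows \<G> \<Longrightarrow> ginv \<G> a \<in> arrows \<G>"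
  and src_ginv: "a \<in> arrows \<G> \<Longrightarrow> src \<G> (ginv \<G> a) = rng \<G> a"
  and rng_ginv: "a \<in> arrows \<G> \<Longrightarrow> rng \<G> (ginv \<G> a) = src \<G> a"
  and ginv_gmult: "a \<in> arrows \<G> \<Longrightarrow> gmult \<G> (ginv \<G> a) a = src \<G> a"
  and gmult_ginv: "a \<in> arrows \<G> \<Longrightarrow> gmult \<G> a (ginv \<G> a) = rng \<G> a"
  using is_ginv_ginv unfolding is_ginv_def by auto

lemma ginv_ginv: "a \<in> arrows \<G> \<Longrightarrow> ginv \<G> (ginv \<G> a) = a"
  by (rule is_ginv_unique[of "ginv \<G> a"])
    (simp_all add: is_ginv_ginv ginv_closed, simp add: is_ginv_def src_ginv rng_ginv ginv_gmult gmult_ginv)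

lemma gmult_ginv_gmult:
  assumes "a \<in> arrows \<G>" "c \<in> arrows \<G>" "rng \<G> a = rng \<G> c"
  shows "gmult \<G> a (gmult \<G> (ginv \<G> a) c) = c"
  using assms gmult_assoc[of a "ginv \<G> a" c] rng_gmult_left[of c]
  by (simp add: ginv_closed src_ginv rng_ginv gmult_ginv)

lemma ginv_gmult_gmult:
  assumes "a \<in> arrows \<G>" "b \<in> arrows \<G>" "src \<G> a = rng \<G> b"
  shows "gmult \<G> (ginv \<G> a) (gmult \<G> a b) = b"
  using assms gmult_assoc[of "ginv \<G> a" a b] rng_gmult_left[of b]
  by (simp add: ginv_closed src_ginv rng_ginv ginv_gmult)

section \<open>Algebra of products of sets of arrows\<close>

lemma set_gmultI:
  "\<lbrakk>a \<in> A; b \<in> B; src \<G> a = rng \<G> b\<rbrakk> \<Longrightarrow> gmult \<G> a b \<in> set_gmult \<G> A B"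
  unfolding set_gmult_def by blast

lemma set_gmultE:
  assumes "c \<in> set_gmult \<G> A B"
  obtains a b where "a \<in> A" "b \<in> B" "src \<G> a = rng \<G> b" "c = gmult \<G> a b"
  using assms unfolding set_gmult_def by blast

lemma set_gmult_assoc:
  assumes "A \<subseteq> arrows \<G>" "B \<subseteq> arrows \<G>" "C \<subseteq> arrows \<G>"
  shows "set_gmult \<G> (set_gmult \<G> A B) C = set_gmult \<G> A (set_gmult \<G> B C)"
proof (intro equalityI subsetI)
  fix d assume "d \<in> set_gmult \<G> (set_gmult \<G> A B) C"
  then obtain a b c where abc: "a \<in> A" "b \<in> B" "c \<in> C" "src \<G> a = rng \<G> b"
    "src \<G> (gmult \<G> a b) = rng \<G> c" "d = gmult \<G> (gmult \<G> a b) c"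
    by (auto elim!: set_gmultE)
  then have ar: "a \<in> arrows \<G>" "b \<in> arrows \<G>" "c \<in> arrows \<G>" using assms by auto
  then have sb: "src \<G> b = rng \<G> c" using abc src_gmult by metis
  then have "d = gmult \<G> a (gmult \<G> b c)" using abc ar gmult_assoc by simp
  moreover have "src \<G> a = rng \<G> (gmult \<G> b c)" using abc ar sb rng_gmult by simp
  ultimately show "d \<in> set_gmult \<G> A (set_gmult \<G> B C)"
    using abc sb by (auto intro!: set_gmultI)
next
  fix d assume "d \<in> set_gmult \<G> A (set_gmult \<G> B C)"
  then obtain a b c where abc: "a \<in> A" "b \<in> B" "c \<in> C" "src \<G> b = rng \<G> c"
    "src \<G> a = rng \<G> (gmult \<G> b c)" "d = gmult \<G> a (gmult \<G> b c)"
    by (auto elim!: set_gmultE)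
  then have ar: "a \<in> arrows \<G>" "b \<in> arrows \<G>" "c \<in> arrows \<G>" using assms by auto
  then have sa: "src \<G> a = rng \<G> b" using abc rng_gmult by metis
  then have "d = gmult \<G> (gmult \<G> a b) c" using abc ar gmult_assoc by simp
  moreover have "src \<G> (gmult \<G> a b) = rng \<G> c" using abc ar sa src_gmult by simp
  ultimately show "d \<in> set_gmult \<G> (set_gmult \<G> A B) C"
    using abc sa by (auto intro!: set_gmultI)
qed

lemma set_gmult_units_left: "A \<subseteq> arrows \<G> \<Longrightarrow> set_gmult \<G> (units \<G>) A = A"
proof (intro equalityI subsetI)
  fix a assume "A \<subseteq> arrows \<G>" "a \<in> set_gmult \<G> (units \<G>) A"
  then show "a \<in> A"
    using rng_gmult_left src_unit by (auto elim!: set_gmultE simp: subset_iff)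
next
  fix a assume "A \<subseteq> arrows \<G>" "a \<in> A"
  then show "a \<in> set_gmult \<G> (units \<G>) A"
    using set_gmultI[of "rng \<G> a" "units \<G>" a A] rng_in_units src_rng rng_gmult_left by auto
qed

text \<open>The inverse of \<open>a\<close> is composable with \<open>b\<close> only when
  \<open>a\<close> and \<open>b\<close> have the same range. Injectivity of \<open>rng\<close> then
  forces \<open>a = b\<close>, so only sources remain.\<close>

lemma set_gmult_ginv_left:
  assumes "A \<subseteq> arrows \<G>" "inj_on (rng \<G>) A"
  shows "set_gmult \<G> (ginv \<G> ` A) A = src \<G> ` A"
proof (intro equalityI subsetI)
  fix c assume "c \<in> set_gmult \<G> (ginv \<G> ` A) A"
  then obtain a b where ab: "a \<in> A" "b \<in> A" "src \<G> (ginv \<G> a) = rng \<G> b"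
    "c = gmult \<G> (ginv \<G> a) b"
    by (auto elim!: set_gmultE)
  then have "rng \<G> a = rng \<G> b" using src_ginv assms by auto
  then have "a = b" using assms ab by (auto dest: inj_onD)
  then show "c \<in> src \<G> ` A" using ab assms ginv_gmult by auto
next
  fix c assume "c \<in> src \<G> ` A"
  then obtain a where a: "a \<in> A" "c = src \<G> a" by auto
  then have "c = gmult \<G> (ginv \<G> a) a" "src \<G> (ginv \<G> a) = rng \<G> a"
    using assms ginv_gmult src_ginv by auto
  then show "c \<in> set_gmult \<G> (ginv \<G> ` A) A" using a by (auto intro!: set_gmultI)
qed

lemma set_gmult_ginv_right:
  assumes "A \<subseteq> arrows \<G>" "inj_on (src \<G>) A"
  shows "set_gmult \<G> A (ginv \<G> ` A) = rng \<G> ` A"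
proof (intro equalityI subsetI)
  fix c assume "c \<in> set_gmult \<G> A (ginv \<G> ` A)"
  then obtain a b where ab: "a \<in> A" "b \<in> A" "src \<G> a = rng \<G> (ginv \<G> b)"
    "c = gmult \<G> a (ginv \<G> b)"
    by (auto elim!: set_gmultE)
  then have "src \<G> a = src \<G> b" using rng_ginv assms by auto
  then have "a = b" using assms ab by (auto dest: inj_onD)
  then show "c \<in> rng \<G> ` A" using ab assms gmult_ginv by auto
next
  fix c assume "c \<in> rng \<G> ` A"
  then obtain a where a: "a \<in> A" "c = rng \<G> a" by auto
  then have "c = gmult \<G> a (ginv \<G> a)" "src \<G> a = rng \<G> (ginv \<G> a)"
    using assms gmult_ginv rng_ginv by auto
  then show "c \<in> set_gmult \<G> A (ginv \<G> ` A)" using a by (auto intro!: set_gmultI)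
qed

lemma set_gmult_image_src_right:
  assumes "A \<subseteq> arrows \<G>"
  shows "set_gmult \<G> A (src \<G> ` A) = A"
proof (intro equalityI subsetI)
  fix c assume "c \<in> set_gmult \<G> A (src \<G> ` A)"
  then show "c \<in> A"
    using assms gmult_src rng_src by (auto elim!: set_gmultE simp: subset_iff) metis
next
  fix c assume "c \<in> A"
  then show "c \<in> set_gmult \<G> A (src \<G> ` A)"
    using assms set_gmultI[of c A "src \<G> c"] rng_src gmult_src by auto
qed

lemma inj_on_src_set_gmult:
  assumes "A \<subseteq> arrows \<G>" "B \<subseteq> arrows \<G>" "inj_on (src \<G>) A" "inj_on (src \<G>) B"
  shows "inj_on (src \<G>) (set_gmult \<G> A B)"
proof (rule inj_onI)
  fix c d assume "c \<in> set_gmult \<G> A B" "d \<in> set_gmult \<G> A B" and eq: "src \<G> c = src \<G> d"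
  then obtain a b a' b' where *: "a \<in> A" "b \<in> B" "src \<G> a = rng \<G> b" "c = gmult \<G> a b"
    "a' \<in> A" "b' \<in> B" "src \<G> a' = rng \<G> b'" "d = gmult \<G> a' b'"
    by (metis set_gmultE)
  then have "src \<G> b = src \<G> b'" using eq assms src_gmult by (metis subsetD)
  then have "b = b'" using * assms by (auto dest: inj_onD)
  moreover from this have "a = a'" using * assms by (metis inj_onD)
  ultimately show "c = d" using * by simp
qed

lemma inj_on_rng_set_gmult:
  assumes "A \<subseteq> arrows \<G>" "B \<subseteq> arrows \<G>" "inj_on (rng \<G>) A" "inj_on (rng \<G>) B"
  shows "inj_on (rng \<G>) (set_gmult \<G> A B)"
proof (rule inj_onI)
  fix c d assume "c \<in> set_gmult \<G> A B" "d \<in> set_gmult \<G> A B" and eq: "rng \<G> c = rng \<G> d"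
  then obtain a b a' b' where *: "a \<in> A" "b \<in> B" "src \<G> a = rng \<G> b" "c = gmult \<G> a b"
    "a' \<in> A" "b' \<in> B" "src \<G> a' = rng \<G> b'" "d = gmult \<G> a' b'"
    by (metis set_gmultE)
  then have "rng \<G> a = rng \<G> a'" using eq assms rng_gmult by (metis subsetD)
  then have "a = a'" using * assms by (auto dest: inj_onD)
  moreover from this have "b = b'" using * assms by (metis inj_onD)
  ultimately show "c = d" using * by simp
qed

lemma src_image_ginv: "A \<subseteq> arrows \<G> \<Longrightarrow> src \<G> ` ginv \<G> ` A = rng \<G> ` A"
  and rng_image_ginv: "A \<subseteq> arrows \<G> \<Longrightarrow> rng \<G> ` ginv \<G> ` A = src \<G> ` A"
  unfolding image_image by (rule image_cong, rule refl, metis src_ginv rng_ginv subsetD)+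

lemma src_image_set_gmult:
  assumes "A \<subseteq> arrows \<G>" "B \<subseteq> arrows \<G>"
  shows "src \<G> ` set_gmult \<G> A B = src \<G> ` {b \<in> B. rng \<G> b \<in> src \<G> ` A}"
proof (intro equalityI subsetI)
  fix x assume "x \<in> src \<G> ` set_gmult \<G> A B"
  then obtain a b where "a \<in> A" "b \<in> B" "src \<G> a = rng \<G> b" "x = src \<G> (gmult \<G> a b)"
    by (auto elim!: set_gmultE)
  then show "x \<in> src \<G> ` {b \<in> B. rng \<G> b \<in> src \<G> ` A}"
    using src_gmult[of a b] assms by (auto simp: image_iff subset_iff intro!: bexI[of _ a] exI[of _ b])
next
  fix x assume "x \<in> src \<G> ` {b \<in> B. rng \<G> b \<in> src \<G> ` A}"
  then obtain a b where "a \<in> A" "b \<in> B" "src \<G> a = rng \<G> b" "x = src \<G> b"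
    by (auto simp: image_iff)
  then show "x \<in> src \<G> ` set_gmult \<G> A B"
    using src_gmult[of a b] assms set_gmultI[of a A b B] by (metis imageI subsetD)
qed

lemma rng_image_set_gmult:
  assumes "A \<subseteq> arrows \<G>" "B \<subseteq> arrows \<G>"
  shows "rng \<G> ` set_gmult \<G> A B = rng \<G> ` {a \<in> A. src \<G> a \<in> rng \<G> ` B}"
proof (intro equalityI subsetI)
  fix x assume "x \<in> rng \<G> ` set_gmult \<G> A B"
  then obtain a b where "a \<in> A" "b \<in> B" "src \<G> a = rng \<G> b" "x = rng \<G> (gmult \<G> a b)"
    by (auto elim!: set_gmultE)
  then show "x \<in> rng \<G> ` {a \<in> A. src \<G> a \<in> rng \<G> ` B}"
    using rng_gmult[of a b] assms by (auto simp: image_iff subset_iff intro!: bexI[of _ b] exI[of _ a])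
next
  fix x assume "x \<in> rng \<G> ` {a \<in> A. src \<G> a \<in> rng \<G> ` B}"
  then obtain a b where "a \<in> A" "b \<in> B" "src \<G> a = rng \<G> b" "x = rng \<G> a"
    by (auto simp: image_iff)
  then show "x \<in> rng \<G> ` set_gmult \<G> A B"
    using rng_gmult[of a b] assms set_gmultI[of a A b B] by (metis imageI subsetD)
qed

end

section \<open>Continuity and openness of the structure maps\<close>

context etale_groupoid
begin

lemma topspace_unit_space: "topspace (unit_space \<G>) = units \<G>"
  using units_subset by auto

lemma bisection_openin: "bisection \<G> F \<Longrightarrow> openin (gtop \<G>) F"
  and bisection_compactin: "bisection \<G> F \<Longrightarrow> compactin (gtop \<G>) F"
  unfolding bisection_def by auto

lemma bisection_subset: "bisection \<G> F \<Longrightarrow> F \<subseteq> arrows \<G>"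
  by (rule openin_subset[OF bisection_openin])

lemma bisection_arrow: "\<lbrakk>bisection \<G> F; a \<in> F\<rbrakk> \<Longrightarrow> a \<in> arrows \<G>"
  using bisection_subset by blast

lemma bisection_inj_src: "bisection \<G> F \<Longrightarrow> inj_on (src \<G>) F"
  and bisection_inj_rng: "bisection \<G> F \<Longrightarrow> inj_on (rng \<G>) F"
proof -
  assume F: "bisection \<G> F"
  then have top: "topspace (subtopology (gtop \<G>) F) = F"
    using bisection_subset by (simp add: Int_absorb1)
  show "inj_on (src \<G>) F" "inj_on (rng \<G>) F"
    using F homeomorphic_imp_injective_map unfolding bisection_def by (metis top)+
qed

lemma bisection_nhd:
  assumes "openin (gtop \<G>) S" "a \<in> S"
  obtains C where "bisection \<G> C" "a \<in> C" "C \<subseteq> S"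
  using assms unfolding bisection_basis union_of_def by blast

text \<open>Continuity of \<open>src\<close> and \<open>rng\<close> is not an axiom. Bisections form
  an open cover on each member of which both maps are homeomorphisms onto their images, and
  continuity is a local matter.\<close>

lemma continuous_map_into_units:
  assumes "\<And>C. bisection \<G> C \<Longrightarrow> continuous_map (subtopology (gtop \<G>) C) (unit_space \<G>) f"
  shows "continuous_map (gtop \<G>) (unit_space \<G>) f"
  unfolding continuous_map_def
proof (intro conjI allI impI funcsetI)
  show "f a \<in> topspace (unit_space \<G>)" if a: "a \<in> arrows \<G>" for a
  proof -
    obtain C where C: "bisection \<G> C" "a \<in> C" using a bisection_nhd by blast
    then have "a \<in> topspace (subtopology (gtop \<G>) C)" using a by simp
    then show ?thesis using continuous_map_image_subset_topspace[OF assms[OF C(1)]] by blast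
  qed
next
  fix V assume V: "openin (unit_space \<G>) V"
  show "openin (gtop \<G>) {a \<in> arrows \<G>. f a \<in> V}"
  proof (subst openin_subopen, intro ballI)
    fix a assume a: "a \<in> {a \<in> arrows \<G>. f a \<in> V}"
    then obtain C where C: "bisection \<G> C" "a \<in> C" using bisection_nhd[of "arrows \<G>" a] by blast
    have "openin (subtopology (gtop \<G>) C) {c \<in> topspace (subtopology (gtop \<G>) C). f c \<in> V}"
      using openin_continuous_map_preimage[OF assms[OF C(1)] V] .
    then have "openin (gtop \<G>) {c \<in> topspace (subtopology (gtop \<G>) C). f c \<in> V}"
      using openin_open_subtopology[OF bisection_openin[OF C(1)]] by blast
    then show "\<exists>T. openin (gtop \<G>) T \<and> a \<in> T \<and> T \<subseteq> {a \<in> arrows \<G>. f a \<in> V}"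
      using a C by (intro exI[of _ "{c \<in> topspace (subtopology (gtop \<G>) C). f c \<in> V}"]) auto
  qed
qed

lemma bisection_continuous:
  assumes "bisection \<G> C"
  shows "continuous_map (subtopology (gtop \<G>) C) (unit_space \<G>) (src \<G>)"
    and "continuous_map (subtopology (gtop \<G>) C) (unit_space \<G>) (rng \<G>)"
proof -
  have "homeomorphic_map (subtopology (gtop \<G>) C) (subtopology (unit_space \<G>) (src \<G> ` C)) (src \<G>)"
    and "homeomorphic_map (subtopology (gtop \<G>) C) (subtopology (unit_space \<G>) (rng \<G> ` C)) (rng \<G>)"
    using assms by (auto simp only: bisection_def)
  from this[THEN homeomorphic_imp_continuous_map, THEN continuous_map_into_fulltopology]
  show "continuous_map (subtopology (gtop \<G>) C) (unit_space \<G>) (src \<G>)"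
    and "continuous_map (subtopology (gtop \<G>) C) (unit_space \<G>) (rng \<G>)" .
qed

lemma continuous_src: "continuous_map (gtop \<G>) (unit_space \<G>) (src \<G>)"
  and continuous_rng: "continuous_map (gtop \<G>) (unit_space \<G>) (rng \<G>)"
  by (rule continuous_map_into_units, erule bisection_continuous)+

lemma open_src: "openin (gtop \<G>) S \<Longrightarrow> openin (unit_space \<G>) (src \<G> ` S)"
proof (subst openin_subopen, intro ballI)
  fix x assume "openin (gtop \<G>) S" "x \<in> src \<G> ` S"
  then obtain a C where "bisection \<G> C" "a \<in> C" "C \<subseteq> S" "x = src \<G> a"
    using bisection_nhd by (metis imageE)
  then show "\<exists>T. openin (unit_space \<G>) T \<and> x \<in> T \<and> T \<subseteq> src \<G> ` S"
    unfolding bisection_def by blast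
qed

lemma open_rng: "openin (gtop \<G>) S \<Longrightarrow> openin (unit_space \<G>) (rng \<G> ` S)"
proof (subst openin_subopen, intro ballI)
  fix x assume "openin (gtop \<G>) S" "x \<in> rng \<G> ` S"
  then obtain a C where "bisection \<G> C" "a \<in> C" "C \<subseteq> S" "x = rng \<G> a"
    using bisection_nhd by (metis imageE)
  then show "\<exists>T. openin (unit_space \<G>) T \<and> x \<in> T \<and> T \<subseteq> rng \<G> ` S"
    unfolding bisection_def by blast
qed

lemma homeomorphic_map_restrict_open:
  assumes cont: "continuous_map (gtop \<G>) (unit_space \<G>) f"
    and op: "\<And>S. openin (gtop \<G>) S \<Longrightarrow> openin (unit_space \<G>) (f ` S)"
    and F: "openin (gtop \<G>) F" "inj_on f F"
  shows "homeomorphic_map (subtopology (gtop \<G>) F) (subtopology (unit_space \<G>) (f ` F)) f"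
proof (rule bijective_open_imp_homeomorphic_map)
  have sub: "F \<subseteq> arrows \<G>" using F openin_subset by blast
  have img: "f ` F \<subseteq> topspace (unit_space \<G>)" using op[OF F(1)] openin_subset by blast
  show "continuous_map (subtopology (gtop \<G>) F) (subtopology (unit_space \<G>) (f ` F)) f"
    using cont by (auto simp: continuous_map_in_subtopology continuous_map_from_subtopology)
  show "open_map (subtopology (gtop \<G>) F) (subtopology (unit_space \<G>) (f ` F)) f"
    unfolding open_map_def
    by (metis F(1) op openin_open_subtopology image_mono)
  show "f ` topspace (subtopology (gtop \<G>) F) = topspace (subtopology (unit_space \<G>) (f ` F))"
    using sub img by (simp add: Int_absorb1 Int_absorb2)
  show "inj_on f (topspace (subtopology (gtop \<G>) F))"
    using F sub by (simp add: Int_absorb1)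
qed

text \<open>Once \<open>F\<close> is open and both maps are injective on it, \<open>src\<close> is a
  homeomorphism onto its image, and compactness of the image travels back to
  \<open>F\<close>.\<close>

lemma bisectionI:
  assumes F: "openin (gtop \<G>) F" "inj_on (src \<G>) F" "inj_on (rng \<G>) F"
    and comp: "compactin (unit_space \<G>) (src \<G> ` F)"
  shows "bisection \<G> F"
proof -
  have hs: "homeomorphic_map (subtopology (gtop \<G>) F) (subtopology (unit_space \<G>) (src \<G> ` F)) (src \<G>)"
    using homeomorphic_map_restrict_open continuous_src open_src F by blast
  moreover have "homeomorphic_map (subtopology (gtop \<G>) F) (subtopology (unit_space \<G>) (rng \<G> ` F)) (rng \<G>)"
    using homeomorphic_map_restrict_open continuous_rng open_rng F by blast
  moreover have "compactin (gtop \<G>) F"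
  proof -
    have "compact_space (subtopology (unit_space \<G>) (src \<G> ` F))"
      using comp compactin_subspace by blast
    then have "compact_space (subtopology (gtop \<G>) F)"
      using hs homeomorphic_compact_space homeomorphic_map_imp_homeomorphic_space by blast
    then show ?thesis using openin_subset[OF F(1)] by (simp add: compactin_subspace)
  qed
  ultimately show ?thesis
    unfolding bisection_def using F(1) open_src[OF F(1)] open_rng[OF F(1)] by - (intro conjI, assumption+)
qed

text \<open>Around a unit, choose a bisection \<open>C\<close>. An arrow \<open>a\<close> of
  \<open>C\<close> whose source lies in \<open>C\<close> shares its source with the unit
  \<open>src \<G> a\<close>, so injectivity on \<open>C\<close> makes \<open>a\<close> a
  unit.\<close>

lemma openin_units: "openin (gtop \<G>) (units \<G>)"
proof (subst openin_subopen, intro ballI)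
  fix x assume x: "x \<in> units \<G>"
  then obtain C where C: "bisection \<G> C" "x \<in> C"
    using bisection_nhd[of "arrows \<G>" x] units_subset by blast
  have "openin (unit_space \<G>) (C \<inter> units \<G>)"
    using bisection_openin[OF C(1)] by (simp add: openin_subtopology_Int)
  then have "openin (gtop \<G>) {a \<in> arrows \<G>. src \<G> a \<in> C \<inter> units \<G>}"
    using openin_continuous_map_preimage[OF continuous_src] by blast
  then have op: "openin (gtop \<G>) (C \<inter> {a \<in> arrows \<G>. src \<G> a \<in> C \<inter> units \<G>})"
    using bisection_openin[OF C(1)] by blast
  have "a \<in> units \<G>" if "a \<in> C" "src \<G> a \<in> C \<inter> units \<G>" for a
  proof -
    have "src \<G> (src \<G> a) = src \<G> a" using that src_unit by blast
    then have "src \<G> a = a" using that bisection_inj_src[OF C(1)] by (auto dest: inj_onD)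
    then show ?thesis using that by auto
  qed
  then have "C \<inter> {a \<in> arrows \<G>. src \<G> a \<in> C \<inter> units \<G>} \<subseteq> units \<G>" by blast
  moreover have "x \<in> C \<inter> {a \<in> arrows \<G>. src \<G> a \<in> C \<inter> units \<G>}"
    using C x units_subset src_unit by auto
  ultimately show "\<exists>T. openin (gtop \<G>) T \<and> x \<in> T \<and> T \<subseteq> units \<G>" using op by blast
qed

lemma openin_ginv:
  assumes "openin (gtop \<G>) S"
  shows "openin (gtop \<G>) (ginv \<G> ` S)"
proof -
  have "ginv \<G> ` S = {a \<in> arrows \<G>. ginv \<G> a \<in> S}"
  proof (intro equalityI subsetI)
    show "a \<in> {a \<in> arrows \<G>. ginv \<G> a \<in> S}" if "a \<in> ginv \<G> ` S" for a
      using that openin_subset[OF assms] ginv_closed ginv_ginv by auto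
    show "a \<in> ginv \<G> ` S" if "a \<in> {a \<in> arrows \<G>. ginv \<G> a \<in> S}" for a
      using that ginv_ginv[of a] by (auto intro: rev_image_eqI)
  qed
  then show ?thesis using openin_continuous_map_preimage[OF continuous_ginv assms] by simp
qed

text \<open>Let \<open>q\<close> be the continuous inverse of \<open>rng\<close> on
  \<open>A\<close>. An arrow \<open>c\<close> whose range is a range of \<open>A\<close> has a
  single candidate \<open>a = q (rng \<G> c)\<close> for its left factor, so the product is the
  preimage of \<open>B\<close> under \<open>c \<mapsto> a\<^sup>-\<^sup>1 c\<close>, which is
  continuous on the open set \<open>R\<close>.\<close>

lemma openin_set_gmult:
  assumes A: "bisection \<G> A" and B: "openin (gtop \<G>) B"
  shows "openin (gtop \<G>) (set_gmult \<G> A B)"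
proof -
  have subA: "A \<subseteq> arrows \<G>" and subB: "B \<subseteq> arrows \<G>"
    using A B bisection_subset openin_subset by auto
  define R where "R = {c \<in> arrows \<G>. rng \<G> c \<in> rng \<G> ` A}"
  have opR: "openin (gtop \<G>) R"
    unfolding R_def using openin_continuous_map_preimage[OF continuous_rng]
      open_rng[OF bisection_openin[OF A]] by blast
  have "homeomorphic_map (subtopology (gtop \<G>) A) (subtopology (unit_space \<G>) (rng \<G> ` A)) (rng \<G>)"
    using A bisection_def by blast
  then obtain q where q: "homeomorphic_maps (subtopology (gtop \<G>) A)
      (subtopology (unit_space \<G>) (rng \<G> ` A)) (rng \<G>) q"
    using homeomorphic_map_maps by blast
  have qr: "q (rng \<G> a) = a" if "a \<in> A" for a
    using q that subA unfolding homeomorphic_maps_def by auto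
  let ?T = "subtopology (gtop \<G>) R"
  have c1: "continuous_map ?T (subtopology (unit_space \<G>) (rng \<G> ` A)) (rng \<G>)"
    by (rule continuous_map_into_subtopology
        [OF continuous_map_from_subtopology[OF continuous_rng]]) (auto simp: R_def)
  have "continuous_map (subtopology (unit_space \<G>) (rng \<G> ` A)) (subtopology (gtop \<G>) A) q"
    using q unfolding homeomorphic_maps_def by blast
  then have "continuous_map (subtopology (unit_space \<G>) (rng \<G> ` A)) (gtop \<G>) q"
    using continuous_map_into_fulltopology by blast
  then have "continuous_map ?T (gtop \<G>) (q \<circ> rng \<G>)"
    using continuous_map_compose c1 by blast
  then have c2: "continuous_map ?T (gtop \<G>) (ginv \<G> \<circ> (q \<circ> rng \<G>))"
    using continuous_map_compose continuous_ginv by blast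
  have "continuous_map ?T (prod_topology (gtop \<G>) (gtop \<G>)) (\<lambda>c. ((ginv \<G> \<circ> (q \<circ> rng \<G>)) c, c))"
    using continuous_map_from_subtopology[OF continuous_map_id, of "gtop \<G>" R]
    by (intro continuous_map_pairedI c2) (simp add: id_def)
  \<comment> \<open>Multiplication is continuous on the subspace of composable pairs, so the pairing
    has to land there.\<close>
  moreover have "(\<lambda>c. ((ginv \<G> \<circ> (q \<circ> rng \<G>)) c, c)) \<in> topspace ?T \<rightarrow> {(a, b). src \<G> a = rng \<G> b}"
    using qr subA src_ginv by (auto simp: R_def)
  ultimately have "continuous_map ?T
       (subtopology (prod_topology (gtop \<G>) (gtop \<G>)) {(a, b). src \<G> a = rng \<G> b})
       (\<lambda>c. ((ginv \<G> \<circ> (q \<circ> rng \<G>)) c, c))"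
    by (intro continuous_map_into_subtopology) auto
  then have "continuous_map ?T (gtop \<G>)
      ((\<lambda>(a, b). gmult \<G> a b) \<circ> (\<lambda>c. ((ginv \<G> \<circ> (q \<circ> rng \<G>)) c, c)))"
    using continuous_map_compose continuous_gmult by blast
  then have "openin ?T {c \<in> topspace ?T. ((\<lambda>(a, b). gmult \<G> a b) \<circ> (\<lambda>c. ((ginv \<G> \<circ> (q \<circ> rng \<G>)) c, c))) c \<in> B}"
    using openin_continuous_map_preimage B by blast
  then have "openin (gtop \<G>) {c \<in> R. gmult \<G> (ginv \<G> (q (rng \<G> c))) c \<in> B}"
    using opR by (simp add: openin_open_subtopology R_def)
  moreover have "set_gmult \<G> A B = {c \<in> R. gmult \<G> (ginv \<G> (q (rng \<G> c))) c \<in> B}"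
  proof (intro equalityI subsetI)
    fix c assume "c \<in> set_gmult \<G> A B"
    then obtain a b where ab: "a \<in> A" "b \<in> B" "src \<G> a = rng \<G> b" "c = gmult \<G> a b"
      by (auto elim!: set_gmultE)
    then have ar: "a \<in> arrows \<G>" "b \<in> arrows \<G>" using subA subB by auto
    then have "rng \<G> c = rng \<G> a" using ab rng_gmult by simp
    then show "c \<in> {c \<in> R. gmult \<G> (ginv \<G> (q (rng \<G> c))) c \<in> B}"
      using ab ar qr ginv_gmult_gmult gmult_closed unfolding R_def by auto
  next
    fix c assume c: "c \<in> {c \<in> R. gmult \<G> (ginv \<G> (q (rng \<G> c))) c \<in> B}"
    then obtain a where a: "a \<in> A" "rng \<G> a = rng \<G> c" "c \<in> arrows \<G>" unfolding R_def by auto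
    then have "gmult \<G> (ginv \<G> a) c \<in> B" using c qr by (metis (mono_tags, lifting) mem_Collect_eq)
    moreover have "gmult \<G> a (gmult \<G> (ginv \<G> a) c) = c"
      using a subA gmult_ginv_gmult by blast
    moreover have "src \<G> a = rng \<G> (gmult \<G> (ginv \<G> a) c)"
      using a subA rng_gmult[of "ginv \<G> a" c] ginv_closed src_ginv rng_ginv by auto
    ultimately show "c \<in> set_gmult \<G> A B" using a set_gmultI by metis
  qed
  ultimately show ?thesis by simp
qed

end

section \<open>The full group and its action on the unit space\<close>

text \<open>These two properties of the Cantor set carry the calculus of bisections: for sets of
  units, closed and compact mean the same. Absence of isolated points enters together with
  minimality.\<close>

locale ample_groupoid = etale_groupoid +
  assumes compact_units: "compact_space (unit_space \<G>)"
    and Hausdorff_units: "Hausdorff_space (unit_space \<G>)"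
begin

lemma src_image_open: "bisection \<G> F \<Longrightarrow> openin (unit_space \<G>) (src \<G> ` F)"
  by (rule open_src, erule bisection_openin)

lemma src_image_closed: "bisection \<G> F \<Longrightarrow> closedin (unit_space \<G>) (src \<G> ` F)"
  and rng_image_closed: "bisection \<G> F \<Longrightarrow> closedin (unit_space \<G>) (rng \<G> ` F)"
  using image_compactin[OF bisection_compactin continuous_src]
    image_compactin[OF bisection_compactin continuous_rng]
    compactin_imp_closedin[OF Hausdorff_units] by metis+

lemma bisectionI_closed:
  assumes "openin (gtop \<G>) F" "inj_on (src \<G>) F" "inj_on (rng \<G>) F"
    "closedin (unit_space \<G>) (src \<G> ` F)"
  shows "bisection \<G> F"
  by (rule bisectionI[OF assms(1-3)]) (rule closedin_compact_space[OF compact_units assms(4)])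

lemma bisection_set_gmult:
  assumes A: "bisection \<G> A" and B: "bisection \<G> B"
  shows "bisection \<G> (set_gmult \<G> A B)"
proof (rule bisectionI_closed)
  show "openin (gtop \<G>) (set_gmult \<G> A B)"
    by (rule openin_set_gmult[OF A bisection_openin[OF B]])
  show "inj_on (src \<G>) (set_gmult \<G> A B)" "inj_on (rng \<G>) (set_gmult \<G> A B)"
    by (simp_all add: inj_on_src_set_gmult inj_on_rng_set_gmult A B bisection_subset
        bisection_inj_src bisection_inj_rng)
  \<comment> \<open>Only arrows of \<open>B\<close> whose range is a source of \<open>A\<close> have
    a composable partner. They form a closed part of the compact \<open>B\<close>, so their sources
    form a compact, hence closed, set.\<close>
  have "closedin (gtop \<G>) {b \<in> arrows \<G>. rng \<G> b \<in> src \<G> ` A}"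
    by (rule closedin_continuous_map_preimage[OF continuous_rng src_image_closed[OF A]])
  then have "compactin (gtop \<G>) ({b \<in> arrows \<G>. rng \<G> b \<in> src \<G> ` A} \<inter> B)"
    by (rule closed_Int_compactin[OF _ bisection_compactin[OF B]])
  moreover have "{b \<in> arrows \<G>. rng \<G> b \<in> src \<G> ` A} \<inter> B = {b \<in> B. rng \<G> b \<in> src \<G> ` A}"
    using bisection_subset[OF B] by blast
  ultimately have "compactin (gtop \<G>) {b \<in> B. rng \<G> b \<in> src \<G> ` A}" by simp
  then have "compactin (unit_space \<G>) (src \<G> ` {b \<in> B. rng \<G> b \<in> src \<G> ` A})"
    by (rule image_compactin[OF _ continuous_src])
  then show "closedin (unit_space \<G>) (src \<G> ` set_gmult \<G> A B)"
    unfolding src_image_set_gmult[OF bisection_subset[OF A] bisection_subset[OF B]]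
    by (rule compactin_imp_closedin[OF Hausdorff_units])
qed

lemma bisection_ginv:
  assumes A: "bisection \<G> A"
  shows "bisection \<G> (ginv \<G> ` A)"
proof (rule bisectionI_closed)
  have sub: "A \<subseteq> arrows \<G>" by (rule bisection_subset[OF A])
  show "openin (gtop \<G>) (ginv \<G> ` A)" by (rule openin_ginv[OF bisection_openin[OF A]])
  show "closedin (unit_space \<G>) (src \<G> ` ginv \<G> ` A)"
    unfolding src_image_ginv[OF sub] by (rule rng_image_closed[OF A])
  show "inj_on (src \<G>) (ginv \<G> ` A)"
    using bisection_inj_rng[OF A] sub by (auto simp: inj_on_def src_ginv subset_iff)
  show "inj_on (rng \<G>) (ginv \<G> ` A)"
    using bisection_inj_src[OF A] sub by (auto simp: inj_on_def rng_ginv subset_iff)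
qed

lemma bisection_units: "bisection \<G> (units \<G>)"
proof (rule bisectionI_closed)
  have "src \<G> ` units \<G> = units \<G>" using src_unit by auto
  then show "closedin (unit_space \<G>) (src \<G> ` units \<G>)"
    using topspace_unit_space by (metis closedin_topspace)
qed (auto simp: inj_on_def src_unit rng_unit openin_units)

text \<open>For a set \<open>V\<close> of units this is the product of \<open>B\<close> and
  \<open>V\<close>. Cutting by sources, not by ranges, keeps all members of a family over a common
  source set in step.\<close>

definition restrict_src :: "'a set \<Rightarrow> 'a set \<Rightarrow> 'a set" where
  "restrict_src B V = {b \<in> B. src \<G> b \<in> V}"

definition clopen :: "'a set \<Rightarrow> bool" where
  "clopen V \<longleftrightarrow> openin (unit_space \<G>) V \<and> closedin (unit_space \<G>) V"

lemma clopen_subset: "clopen V \<Longrightarrow> V \<subseteq> units \<G>"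
  unfolding clopen_def using openin_subset topspace_unit_space by blast

lemma clopen_Int: "clopen V \<Longrightarrow> clopen W \<Longrightarrow> clopen (V \<inter> W)"
  and clopen_Un: "clopen V \<Longrightarrow> clopen W \<Longrightarrow> clopen (V \<union> W)"
  and clopen_Diff: "clopen V \<Longrightarrow> clopen W \<Longrightarrow> clopen (V - W)"
  unfolding clopen_def by (auto intro: openin_diff closedin_diff)

lemma clopen_src_image: "bisection \<G> F \<Longrightarrow> clopen (src \<G> ` F)"
  unfolding clopen_def by (simp add: src_image_open src_image_closed)

lemma restrict_src_subset: "restrict_src B V \<subseteq> B"
  unfolding restrict_src_def by blast

lemma src_image_restrict_src: "src \<G> ` restrict_src B V = src \<G> ` B \<inter> V"
  unfolding restrict_src_def by blast

lemma bisection_restrict_src: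
  assumes "bisection \<G> B" "clopen V"
  shows "bisection \<G> (restrict_src B V)"
proof (rule bisectionI_closed)
  have "openin (gtop \<G>) {b \<in> arrows \<G>. src \<G> b \<in> V}"
    using openin_continuous_map_preimage[OF continuous_src] assms clopen_def by blast
  then have "openin (gtop \<G>) (B \<inter> {b \<in> arrows \<G>. src \<G> b \<in> V})"
    using bisection_openin[OF assms(1)] by blast
  moreover have "B \<inter> {b \<in> arrows \<G>. src \<G> b \<in> V} = restrict_src B V"
    using bisection_subset[OF assms(1)] unfolding restrict_src_def by blast
  ultimately show "openin (gtop \<G>) (restrict_src B V)" by simp
  show "closedin (unit_space \<G>) (src \<G> ` restrict_src B V)"
    unfolding src_image_restrict_src
    using src_image_closed[OF assms(1)] assms(2) clopen_def by blast
  show "inj_on (src \<G>) (restrict_src B V)" "inj_on (rng \<G>) (restrict_src B V)"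
    using bisection_inj_src[OF assms(1)] bisection_inj_rng[OF assms(1)] restrict_src_subset
    by (meson inj_on_subset)+
qed

lemma bisection_Union:
  assumes "finite I" and B: "\<And>i. i \<in> I \<Longrightarrow> bisection \<G> (B i)"
    and s: "\<And>i j. \<lbrakk>i \<in> I; j \<in> I; i \<noteq> j\<rbrakk> \<Longrightarrow> src \<G> ` B i \<inter> src \<G> ` B j = {}"
    and r: "\<And>i j. \<lbrakk>i \<in> I; j \<in> I; i \<noteq> j\<rbrakk> \<Longrightarrow> rng \<G> ` B i \<inter> rng \<G> ` B j = {}"
  shows "bisection \<G> (\<Union>i\<in>I. B i)"
proof (rule bisectionI_closed)
  show "openin (gtop \<G>) (\<Union>i\<in>I. B i)" using B bisection_openin by blast
  show "closedin (unit_space \<G>) (src \<G> ` (\<Union>i\<in>I. B i))"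
    unfolding image_UN using assms(1) B src_image_closed by (intro closedin_Union) auto
  have "a = b" if "i \<in> I" "j \<in> I" "a \<in> B i" "b \<in> B j" "src \<G> a = src \<G> b" for i j a b
  proof -
    have "i = j" using s[of i j] that by (auto simp: image_def)
    then show ?thesis using that inj_onD[OF bisection_inj_src[OF B]] by blast
  qed
  then show "inj_on (src \<G>) (\<Union>i\<in>I. B i)" by (auto intro!: inj_onI)
  have "a = b" if "i \<in> I" "j \<in> I" "a \<in> B i" "b \<in> B j" "rng \<G> a = rng \<G> b" for i j a b
  proof -
    have "i = j" using r[of i j] that by (auto simp: image_def)
    then show ?thesis using that inj_onD[OF bisection_inj_rng[OF B]] by blast
  qed
  then show "inj_on (rng \<G>) (\<Union>i\<in>I. B i)" by (auto intro!: inj_onI)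
qed

lemma bisection_clopen:
  assumes "clopen V"
  shows "bisection \<G> V"
proof -
  have "restrict_src (units \<G>) V = V"
    using clopen_subset[OF assms] src_unit unfolding restrict_src_def by auto
  then show ?thesis using bisection_restrict_src[OF bisection_units assms] by simp
qed

lemma full_group_carrier:
  "F \<in> carrier (full_group \<G>) \<longleftrightarrow> bisection \<G> F \<and> src \<G> ` F = units \<G> \<and> rng \<G> ` F = units \<G>"
  and full_group_mult: "monoid.mult (full_group \<G>) = set_gmult \<G>"
  and full_group_one: "\<one>\<^bsub>full_group \<G>\<^esub> = units \<G>"
  unfolding full_group_def by simp_all

lemma full_group_bisection: "F \<in> carrier (full_group \<G>) \<Longrightarrow> bisection \<G> F"
  by (simp add: full_group_carrier)

lemma units_in_full_group: "units \<G> \<in> carrier (full_group \<G>)"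
  unfolding full_group_carrier using bisection_units src_unit rng_unit by auto

lemma group_full_group: "group (full_group \<G>)"
proof (rule groupI)
  fix F F' assume "F \<in> carrier (full_group \<G>)" "F' \<in> carrier (full_group \<G>)"
  then have F: "bisection \<G> F" "src \<G> ` F = units \<G>" "rng \<G> ` F = units \<G>"
    and F': "bisection \<G> F'" "src \<G> ` F' = units \<G>" "rng \<G> ` F' = units \<G>"
    by (simp_all add: full_group_carrier)
  note sub = bisection_subset[OF F(1)] bisection_subset[OF F'(1)]
  have "{b \<in> F'. rng \<G> b \<in> units \<G>} = F'" "{a \<in> F. src \<G> a \<in> units \<G>} = F"
    using F F' by blast+
  then show "F \<otimes>\<^bsub>full_group \<G>\<^esub> F' \<in> carrier (full_group \<G>)"
    unfolding full_group_mult full_group_carrier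
    using bisection_set_gmult[OF F(1) F'(1)] src_image_set_gmult[OF sub] rng_image_set_gmult[OF sub]
      F F' by simp
next
  show "\<one>\<^bsub>full_group \<G>\<^esub> \<in> carrier (full_group \<G>)"
    unfolding full_group_one by (rule units_in_full_group)
next
  fix x y z assume "x \<in> carrier (full_group \<G>)" "y \<in> carrier (full_group \<G>)" "z \<in> carrier (full_group \<G>)"
  then show "x \<otimes>\<^bsub>full_group \<G>\<^esub> y \<otimes>\<^bsub>full_group \<G>\<^esub> z = x \<otimes>\<^bsub>full_group \<G>\<^esub> (y \<otimes>\<^bsub>full_group \<G>\<^esub> z)"
    unfolding full_group_mult
    by (intro set_gmult_assoc bisection_subset full_group_bisection)
next
  fix x assume "x \<in> carrier (full_group \<G>)"
  then show "\<one>\<^bsub>full_group \<G>\<^esub> \<otimes>\<^bsub>full_group \<G>\<^esub> x = x"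
    unfolding full_group_mult full_group_one
    by (intro set_gmult_units_left bisection_subset full_group_bisection)
next
  fix x assume "x \<in> carrier (full_group \<G>)"
  then have x: "bisection \<G> x" "src \<G> ` x = units \<G>" "rng \<G> ` x = units \<G>"
    by (simp_all add: full_group_carrier)
  note sub = bisection_subset[OF x(1)]
  have "ginv \<G> ` x \<in> carrier (full_group \<G>)"
    unfolding full_group_carrier
    using x bisection_ginv src_image_ginv[OF sub] rng_image_ginv[OF sub] by simp
  moreover have "ginv \<G> ` x \<otimes>\<^bsub>full_group \<G>\<^esub> x = \<one>\<^bsub>full_group \<G>\<^esub>"
    unfolding full_group_mult full_group_one
    using set_gmult_ginv_left[OF sub bisection_inj_rng[OF x(1)]] x by simp
  ultimately show "\<exists>y\<in>carrier (full_group \<G>). y \<otimes>\<^bsub>full_group \<G>\<^esub> x = \<one>\<^bsub>full_group \<G>\<^esub>" by blast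
qed

text \<open>\<open>inv_into\<close> selects the arrow of \<open>F\<close> with source
  \<open>x\<close>, which exists and is unique for \<open>F\<close> in the full group and
  \<open>x\<close> a unit. Other values are arbitrary.\<close>

definition act :: "'a set \<Rightarrow> 'a \<Rightarrow> 'a" where
  "act F x = rng \<G> (inv_into F (src \<G>) x)"

lemma act_src: "\<lbrakk>F \<in> carrier (full_group \<G>); a \<in> F\<rbrakk> \<Longrightarrow> act F (src \<G> a) = rng \<G> a"
  unfolding act_def using inv_into_f_f bisection_inj_src full_group_bisection by metis

lemma full_group_arrow:
  assumes "F \<in> carrier (full_group \<G>)" "x \<in> units \<G>"
  obtains a where "a \<in> F" "a \<in> arrows \<G>" "src \<G> a = x" "rng \<G> a = act F x"
proof -
  from assms have "x \<in> src \<G> ` F" by (simp add: full_group_carrier)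
  then show ?thesis
    using that act_src[OF assms(1)] bisection_arrow[OF full_group_bisection[OF assms(1)]] by auto
qed

lemma act_in_units: "\<lbrakk>F \<in> carrier (full_group \<G>); x \<in> units \<G>\<rbrakk> \<Longrightarrow> act F x \<in> units \<G>"
  using full_group_arrow rng_in_units by metis

lemma act_inj:
  assumes "F \<in> carrier (full_group \<G>)" "x \<in> units \<G>" "y \<in> units \<G>" "act F x = act F y"
  shows "x = y"
proof -
  obtain a where "a \<in> F" "src \<G> a = x" "rng \<G> a = act F x" using full_group_arrow assms by metis
  moreover obtain b where "b \<in> F" "src \<G> b = y" "rng \<G> b = act F y" using full_group_arrow assms by metis
  ultimately show ?thesis
    using assms(4) inj_onD[OF bisection_inj_rng[OF full_group_bisection[OF assms(1)]]] by metis
qed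

lemma act_units: "x \<in> units \<G> \<Longrightarrow> act (units \<G>) x = x"
  using act_src[OF units_in_full_group] src_unit rng_unit by metis

lemma act_mult:
  assumes F: "F \<in> carrier (full_group \<G>)" "F' \<in> carrier (full_group \<G>)" and x: "x \<in> units \<G>"
  shows "act (F \<otimes>\<^bsub>full_group \<G>\<^esub> F') x = act F (act F' x)"
proof -
  obtain b where b: "b \<in> F'" "b \<in> arrows \<G>" "src \<G> b = x" "rng \<G> b = act F' x"
    using full_group_arrow F x by metis
  obtain a where a: "a \<in> F" "a \<in> arrows \<G>" "src \<G> a = act F' x" "rng \<G> a = act F (act F' x)"
    using full_group_arrow F x act_in_units by metis
  have "gmult \<G> a b \<in> F \<otimes>\<^bsub>full_group \<G>\<^esub> F'"
    unfolding full_group_mult using a b by (auto intro!: set_gmultI)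
  moreover have "F \<otimes>\<^bsub>full_group \<G>\<^esub> F' \<in> carrier (full_group \<G>)"
    using F group_full_group by (simp add: group.is_monoid monoid.m_closed)
  ultimately have "act (F \<otimes>\<^bsub>full_group \<G>\<^esub> F') (src \<G> (gmult \<G> a b)) = rng \<G> (gmult \<G> a b)"
    by (intro act_src)
  then show ?thesis using a b src_gmult[of a b] rng_gmult[of a b] by simp
qed

lemma act_inv:
  assumes F: "F \<in> carrier (full_group \<G>)" and x: "x \<in> units \<G>"
  shows "act F (act (inv\<^bsub>full_group \<G>\<^esub> F) x) = x"
    and "act (inv\<^bsub>full_group \<G>\<^esub> F) (act F x) = x"
proof -
  interpret group "full_group \<G>" by (rule group_full_group)
  show "act F (act (inv\<^bsub>full_group \<G>\<^esub> F) x) = x"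
    using act_mult[of F "inv\<^bsub>full_group \<G>\<^esub> F" x] act_units F x full_group_one by simp
  show "act (inv\<^bsub>full_group \<G>\<^esub> F) (act F x) = x"
    using act_mult[of "inv\<^bsub>full_group \<G>\<^esub> F" F x] act_units F x full_group_one by simp
qed

text \<open>Diagonal entries consist of units. Multiplying \<open>F i j\<close> by
  \<open>F i i\<close> or \<open>F j j\<close> bounds its sources and ranges from above; the
  products of \<open>F i j\<close> and \<open>F j i\<close> in both orders show that all these units
  occur.\<close>

lemma multisection_src_rng:
  assumes F: "multisection \<G> d F" and ij: "i \<in> {1..d}" "j \<in> {1..d}"
  shows "src \<G> ` F i j = F i i" and "rng \<G> ` F i j = F j j"
proof -
  have bis: "bisection \<G> (F i j)" "bisection \<G> (F j i)"
    and m: "set_gmult \<G> (F j i) (F i j) = F i i" "set_gmult \<G> (F i j) (F i i) = F i j"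
      "set_gmult \<G> (F j j) (F i j) = F i j" "set_gmult \<G> (F i j) (F j i) = F j j"
    and u: "F i i \<subseteq> units \<G>" "F j j \<subseteq> units \<G>"
    using F ij unfolding multisection_def by auto
  note sub = bisection_subset[OF bis(1)] bisection_subset[OF bis(2)]
  show "src \<G> ` F i j = F i i"
  proof (intro equalityI subsetI)
    fix x assume "x \<in> src \<G> ` F i j"
    then obtain a where a: "a \<in> F i j" "x = src \<G> a" by blast
    then have "a \<in> set_gmult \<G> (F i j) (F i i)" using m by simp
    then obtain b c where "b \<in> F i j" "c \<in> F i i" "src \<G> b = rng \<G> c" "a = gmult \<G> b c"
      by (rule set_gmultE)
    then have "x = src \<G> c" using src_gmult[of b c] a sub u units_subset by blast
    then show "x \<in> F i i" using \<open>c \<in> F i i\<close> u src_unit by auto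
  next
    fix x assume x: "x \<in> F i i"
    then obtain b c where "b \<in> F j i" "c \<in> F i j" "src \<G> b = rng \<G> c" "x = gmult \<G> b c"
      using m by (metis set_gmultE)
    then have "src \<G> x = src \<G> c" using src_gmult[of b c] sub by blast
    then have "x = src \<G> c" using x u src_unit by auto
    then show "x \<in> src \<G> ` F i j" using \<open>c \<in> F i j\<close> by blast
  qed
  show "rng \<G> ` F i j = F j j"
  proof (intro equalityI subsetI)
    fix x assume "x \<in> rng \<G> ` F i j"
    then obtain a where a: "a \<in> F i j" "x = rng \<G> a" by blast
    then have "a \<in> set_gmult \<G> (F j j) (F i j)" using m by simp
    then obtain b c where "b \<in> F j j" "c \<in> F i j" "src \<G> b = rng \<G> c" "a = gmult \<G> b c"
      by (rule set_gmultE)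
    then have "x = rng \<G> b" using rng_gmult[of b c] a sub u units_subset by blast
    then show "x \<in> F j j" using \<open>b \<in> F j j\<close> u rng_unit by auto
  next
    fix x assume x: "x \<in> F j j"
    then obtain b c where "b \<in> F i j" "c \<in> F j i" "src \<G> b = rng \<G> c" "x = gmult \<G> b c"
      using m by (metis set_gmultE)
    then have "rng \<G> x = rng \<G> b" using rng_gmult[of b c] sub by blast
    then have "x = rng \<G> b" using x u rng_unit by auto
    then show "x \<in> rng \<G> ` F i j" using \<open>b \<in> F i j\<close> by blast
  qed
qed

lemma multisection_perm_closed:
  assumes F: "multisection \<G> d F" and p: "\<pi> permutes {1..d}"
  shows "multisection_perm \<G> d F \<pi> \<in> carrier (full_group \<G>)"
proof -
  let ?U = "\<Union>i\<in>{1..d}. F i i"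
  have pin: "\<pi> i \<in> {1..d}" if "i \<in> {1..d}" for i using that p permutes_in_image by metis
  have bis: "bisection \<G> (F i (\<pi> i))" "bisection \<G> (F i i)" "F i i \<subseteq> units \<G>" if "i \<in> {1..d}" for i
    using F that pin[OF that] unfolding multisection_def by auto
  have disj: "F i i \<inter> F j j = {}" if "i \<in> {1..d}" "j \<in> {1..d}" "i \<noteq> j" for i j
    using F that unfolding multisection_def by blast
  have s: "src \<G> ` F i (\<pi> i) = F i i" and r: "rng \<G> ` F i (\<pi> i) = F (\<pi> i) (\<pi> i)"
    if "i \<in> {1..d}" for i
    using multisection_src_rng[OF F that pin[OF that]] by auto
  have U: "clopen ?U"
  proof -
    have "clopen (F i i)" if "i \<in> {1..d}" for i
      using clopen_src_image[OF bis(1)[OF that]] s[OF that] by simp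
    then show ?thesis unfolding clopen_def by (auto intro!: closedin_Union)
  qed
  have "clopen (units \<G>)" unfolding clopen_def
    using topspace_unit_space by (metis openin_topspace closedin_topspace)
  then have C: "bisection \<G> (units \<G> - ?U)" using U clopen_Diff bisection_clopen by blast
  have sC: "src \<G> ` (units \<G> - ?U) = units \<G> - ?U" "rng \<G> ` (units \<G> - ?U) = units \<G> - ?U"
    using src_unit rng_unit by auto
  have B: "bisection \<G> (\<Union>i\<in>{1..d}. F i (\<pi> i))"
  proof (rule bisection_Union)
    show "bisection \<G> (F i (\<pi> i))" if "i \<in> {1..d}" for i by (rule bis(1)[OF that])
    show "src \<G> ` F i (\<pi> i) \<inter> src \<G> ` F j (\<pi> j) = {}"
      if "i \<in> {1..d}" "j \<in> {1..d}" "i \<noteq> j" for i j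
      using that s disj by simp
    show "rng \<G> ` F i (\<pi> i) \<inter> rng \<G> ` F j (\<pi> j) = {}"
      if "i \<in> {1..d}" "j \<in> {1..d}" "i \<noteq> j" for i j
    proof -
      have "\<pi> i \<noteq> \<pi> j" using that p by (metis permutes_inverses(2))
      then show ?thesis using that r disj pin by simp
    qed
  qed simp
  have sB: "src \<G> ` (\<Union>i\<in>{1..d}. F i (\<pi> i)) = ?U"
    unfolding image_UN using s by simp
  have "rng \<G> ` (\<Union>i\<in>{1..d}. F i (\<pi> i)) = (\<Union>i\<in>{1..d}. F (\<pi> i) (\<pi> i))"
    unfolding image_UN using r by simp
  also have "\<dots> = (\<Union>k\<in>\<pi> ` {1..d}. F k k)" by simp
  also have "\<pi> ` {1..d} = {1..d}" by (rule permutes_image[OF p])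
  finally have rB: "rng \<G> ` (\<Union>i\<in>{1..d}. F i (\<pi> i)) = ?U" .
  have Uu: "?U \<subseteq> units \<G>" using bis(3) by blast
  \<comment> \<open>A boolean index turns the moved part and its fixed complement into a two-member
    family for \<open>bisection_Union\<close>.\<close>
  let ?T = "\<lambda>b. if b then (\<Union>i\<in>{1..d}. F i (\<pi> i)) else units \<G> - ?U"
  have "bisection \<G> (\<Union>b\<in>UNIV. ?T b)"
    by (rule bisection_Union) (use B C sB rB sC in \<open>auto split: if_splits\<close>)
  moreover have "(\<Union>b\<in>UNIV. ?T b) = multisection_perm \<G> d F \<pi>"
    unfolding multisection_perm_def UNIV_bool by auto
  moreover have "src \<G> ` multisection_perm \<G> d F \<pi> = units \<G>"
    unfolding multisection_perm_def image_Un sB sC using Uu by blast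
  moreover have "rng \<G> ` multisection_perm \<G> d F \<pi> = units \<G>"
    unfolding multisection_perm_def image_Un rB sC using Uu by blast
  ultimately show ?thesis unfolding full_group_carrier by simp
qed

lemma act_multisection_perm:
  assumes "multisection \<G> d F" and "\<pi> permutes {1..d}"
  shows "\<lbrakk>i \<in> {1..d}; a \<in> F i (\<pi> i)\<rbrakk> \<Longrightarrow> act (multisection_perm \<G> d F \<pi>) (src \<G> a) = rng \<G> a"
    and "\<lbrakk>x \<in> units \<G>; \<And>i. i \<in> {1..d} \<Longrightarrow> x \<notin> F i i\<rbrakk> \<Longrightarrow> act (multisection_perm \<G> d F \<pi>) x = x"
proof -
  show "act (multisection_perm \<G> d F \<pi>) (src \<G> a) = rng \<G> a" if "i \<in> {1..d}" "a \<in> F i (\<pi> i)"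
    by (rule act_src[OF multisection_perm_closed[OF assms]])
      (use that in \<open>auto simp: multisection_perm_def\<close>)
  show "act (multisection_perm \<G> d F \<pi>) x = x" if "x \<in> units \<G>" "\<And>i. i \<in> {1..d} \<Longrightarrow> x \<notin> F i i"
  proof -
    have "x \<in> multisection_perm \<G> d F \<pi>" using that by (auto simp: multisection_perm_def)
    then show ?thesis
      using act_src[OF multisection_perm_closed[OF assms], of x] src_unit rng_unit that by simp
  qed
qed

lemma alternating_subset: "alternating_full_group \<G> \<subseteq> carrier (full_group \<G>)"
  and alternating_subgroup: "subgroup (alternating_full_group \<G>) (full_group \<G>)"
proof -
  have "(\<Union>F \<in> {F. multisection \<G> 3 F}. multisection_alt \<G> 3 F) \<subseteq> carrier (full_group \<G>)"
    unfolding multisection_alt_def using multisection_perm_closed by blast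
  then show "subgroup (alternating_full_group \<G>) (full_group \<G>)"
    unfolding alternating_full_group_def by (rule group.generate_is_subgroup[OF group_full_group])
  then show "alternating_full_group \<G> \<subseteq> carrier (full_group \<G>)" by (rule subgroup.subset)
qed

end

section \<open>Permutations of bisection families\<close>

text \<open>Given by cases so that products of explicit cycles can be evaluated index by index; the
  form as a product of transpositions serves for the permutation and parity facts.\<close>

definition cycle3 :: "'i \<Rightarrow> 'i \<Rightarrow> 'i \<Rightarrow> 'i \<Rightarrow> 'i" where
  "cycle3 a b c i = (if i = a then b else if i = b then c else if i = c then a else i)"

lemma cycle3_transpose:
  "\<lbrakk>a \<noteq> b; b \<noteq> c; a \<noteq> c\<rbrakk> \<Longrightarrow> cycle3 a b c = Transposition.transpose a b \<circ> Transposition.transpose b c"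
  by (auto simp: fun_eq_iff cycle3_def Transposition.transpose_def)

lemma cycle3_permutes:
  "\<lbrakk>a \<noteq> b; b \<noteq> c; a \<noteq> c; a \<in> S; b \<in> S; c \<in> S\<rbrakk> \<Longrightarrow> cycle3 a b c permutes S"
  by (simp add: cycle3_transpose permutes_compose permutes_swap_id)

lemma evenperm_cycle3: "\<lbrakk>a \<noteq> b; b \<noteq> c; a \<noteq> c\<rbrakk> \<Longrightarrow> evenperm (cycle3 a b c)"
  by (simp add: cycle3_transpose evenperm_comp permutation_swap_id evenperm_swap)

text \<open>Injectivity leaves six patterns of values. The three that fix exactly one index are
  transpositions, excluded by parity.\<close>

lemma evenperm_3_cases:
  assumes p: "\<pi> permutes {1..3::nat}" and ev: "evenperm \<pi>"
  shows "\<pi> = id \<or> \<pi> = cycle3 1 2 3 \<or> \<pi> = cycle3 1 3 2"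
proof -
  have in3: "\<pi> i = 1 \<or> \<pi> i = 2 \<or> \<pi> i = 3" if "i = 1 \<or> i = 2 \<or> i = 3" for i
    using permutes_in_image[OF p, of i] that by auto
  have out: "\<pi> i = i" if "i \<noteq> 1" "i \<noteq> 2" "i \<noteq> 3" for i
    using permutes_not_in[OF p, of i] that by force
  have inj: "\<pi> i = \<pi> j \<longleftrightarrow> i = j" for i j using permutes_inj[OF p] by (auto dest: injD)
  have no: "\<pi> \<noteq> Transposition.transpose a b" if "a \<noteq> b" for a b using ev that evenperm_swap by metis
  have d: "\<pi> 1 \<noteq> \<pi> 2" "\<pi> 1 \<noteq> \<pi> 3" "\<pi> 2 \<noteq> \<pi> 3" using inj by simp_all
  consider "\<pi> 1 = 1" "\<pi> 2 = 2" "\<pi> 3 = 3" | "\<pi> 1 = 1" "\<pi> 2 = 3" "\<pi> 3 = 2"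
    | "\<pi> 1 = 2" "\<pi> 2 = 1" "\<pi> 3 = 3" | "\<pi> 1 = 2" "\<pi> 2 = 3" "\<pi> 3 = 1"
    | "\<pi> 1 = 3" "\<pi> 2 = 1" "\<pi> 3 = 2" | "\<pi> 1 = 3" "\<pi> 2 = 2" "\<pi> 3 = 1"
    using d in3[of 1] in3[of 2] in3[of 3] by metis
  then show ?thesis
  proof cases
    case 1
    have "\<pi> i = id i" for i using 1 out[of i] by (cases "i = 1"; cases "i = 2"; cases "i = 3") simp_all
    then have "\<pi> = id" by blast
    then show ?thesis by simp
  next
    case 2
    have "\<pi> i = Transposition.transpose 2 3 i" for i
      using 2 out[of i] by (cases "i = 1"; cases "i = 2"; cases "i = 3") (simp_all add: Transposition.transpose_def)
    then have "\<pi> = Transposition.transpose 2 3" by blast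
    then show ?thesis using no by simp
  next
    case 3
    have "\<pi> i = Transposition.transpose 1 2 i" for i
      using 3 out[of i] by (cases "i = 1"; cases "i = 2"; cases "i = 3") (simp_all add: Transposition.transpose_def)
    then have "\<pi> = Transposition.transpose 1 2" by blast
    then show ?thesis using no by simp
  next
    case 4
    have "\<pi> i = cycle3 1 2 3 i" for i
      using 4 out[of i] by (cases "i = 1"; cases "i = 2"; cases "i = 3") (simp_all add: cycle3_def)
    then have "\<pi> = cycle3 1 2 3" by blast
    then show ?thesis by simp
  next
    case 5
    have "\<pi> i = cycle3 1 3 2 i" for i
      using 5 out[of i] by (cases "i = 1"; cases "i = 2"; cases "i = 3") (simp_all add: cycle3_def)
    then have "\<pi> = cycle3 1 3 2" by blast
    then show ?thesis by simp
  next
    case 6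
    have "\<pi> i = Transposition.transpose 1 3 i" for i
      using 6 out[of i] by (cases "i = 1"; cases "i = 2"; cases "i = 3") (simp_all add: Transposition.transpose_def)
    then have "\<pi> = Transposition.transpose 1 3" by blast
    then show ?thesis using no by simp
  qed
qed

lemma Hausdorff_space_separate_finite:
  assumes "Hausdorff_space X" "finite P" "P \<subseteq> topspace X"
  obtains V where "\<And>x. x \<in> P \<Longrightarrow> openin X (V x) \<and> x \<in> V x"
    "\<And>x y. \<lbrakk>x \<in> P; y \<in> P; x \<noteq> y\<rbrakk> \<Longrightarrow> V x \<inter> V y = {}"
proof -
  define Q where "Q x y A B \<longleftrightarrow> openin X A \<and> openin X B \<and> x \<in> A \<and> y \<in> B \<and> A \<inter> B = {}" for x y A B
  have "\<exists>A B. Q x y A B" if "x \<in> P" "y \<in> P" "x \<noteq> y" for x y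
    using assms(1)[unfolded Hausdorff_space_def, rule_format, of x y] that assms(3)
    unfolding Q_def disjnt_def by blast
  then have "\<forall>x y. \<exists>A B. x \<in> P \<and> y \<in> P \<and> x \<noteq> y \<longrightarrow> Q x y A B" by blast
  then obtain A B where "\<And>x y. x \<in> P \<and> y \<in> P \<and> x \<noteq> y \<longrightarrow> Q x y (A x y) (B x y)"
    by metis
  then have AB: "\<And>x y. \<lbrakk>x \<in> P; y \<in> P; x \<noteq> y\<rbrakk> \<Longrightarrow> openin X (A x y) \<and> openin X (B x y) \<and>
      x \<in> A x y \<and> y \<in> B x y \<and> A x y \<inter> B x y = {}"
    unfolding Q_def by simp
  \<comment> \<open>The sets chosen for \<open>(x, y)\<close> and for \<open>(y, x)\<close> are
    unrelated, so the neighbourhood of \<open>x\<close> uses its share of both.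
    \<open>topspace X\<close> keeps the intersection open when \<open>P\<close> is a
    singleton.\<close>
  let ?V = "\<lambda>x. topspace X \<inter> (\<Inter>y\<in>P - {x}. A x y \<inter> B y x)"
  show ?thesis
  proof (rule that)
    fix x assume x: "x \<in> P"
    have "openin X (\<Inter> (insert (topspace X) ((\<lambda>y. A x y \<inter> B y x) ` (P - {x}))))"
      by (rule openin_Inter) (use assms(2) AB x in auto)
    then show "openin X (?V x) \<and> x \<in> ?V x" using AB x assms(3) by auto
  next
    fix x y assume "x \<in> P" "y \<in> P" "x \<noteq> y"
    then show "?V x \<inter> ?V y = {}" using AB[of x y] by blast
  qed
qed

section \<open>Families of bisections with a common source set\<close>

context ample_groupoid
begin

text \<open>A multisection in coordinates: \<open>B j\<close> times the inverse of
  \<open>B i\<close> recovers the entry from \<open>i\<close> to \<open>j\<close>. The source set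
  \<open>W\<close> is only a parameter space and need not be one of the ranges, so arrows issuing
  from one unit can be thickened directly.\<close>

definition bisection_family :: "'i set \<Rightarrow> ('i \<Rightarrow> 'a set) \<Rightarrow> 'a set \<Rightarrow> bool" where
  "bisection_family I B W \<longleftrightarrow> (\<forall>i\<in>I. bisection \<G> (B i) \<and> src \<G> ` B i = W) \<and>
     (\<forall>i\<in>I. \<forall>j\<in>I. i \<noteq> j \<longrightarrow> rng \<G> ` B i \<inter> rng \<G> ` B j = {})"

text \<open>Writing \<open>\<beta> i\<close> for the partial homeomorphism of the unit space induced by \<open>B i\<close>: the full
  group element \<open>g\<close> maps \<open>\<beta> i w\<close> to \<open>\<beta> (\<sigma> i) w\<close> and fixes all other units.\<close>

definition realizes :: "'i set \<Rightarrow> ('i \<Rightarrow> 'a set) \<Rightarrow> ('i \<Rightarrow> 'i) \<Rightarrow> 'a set \<Rightarrow> bool" where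
  "realizes I B \<sigma> g \<longleftrightarrow>
     (\<forall>i\<in>I. \<forall>b\<in>B i. \<forall>c\<in>B (\<sigma> i). src \<G> b = src \<G> c \<longrightarrow> act g (rng \<G> b) = rng \<G> c) \<and>
     (\<forall>x\<in>units \<G>. (\<forall>i\<in>I. x \<notin> rng \<G> ` B i) \<longrightarrow> act g x = x)"

lemma bisection_familyD:
  assumes "bisection_family I B W" "i \<in> I"
  shows "bisection \<G> (B i)" "src \<G> ` B i = W"
  using assms unfolding bisection_family_def by auto

lemma bisection_family_disjoint:
  "\<lbrakk>bisection_family I B W; i \<in> I; j \<in> I; b \<in> B i; c \<in> B j; rng \<G> b = rng \<G> c\<rbrakk> \<Longrightarrow> i = j"
  unfolding bisection_family_def by (metis IntI empty_iff imageI)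

lemma bisection_family_reindex:
  "\<lbrakk>bisection_family (p ` I) B W; inj_on p I\<rbrakk> \<Longrightarrow> bisection_family I (\<lambda>i. B (p i)) W"
  unfolding bisection_family_def by (simp add: inj_on_eq_iff)

lemma bisection_family_restrict:
  assumes "bisection_family I B W" "clopen V" "V \<subseteq> W"
  shows "bisection_family I (\<lambda>i. restrict_src (B i) V) V"
  unfolding bisection_family_def
proof (intro conjI ballI impI)
  fix i assume i: "i \<in> I"
  show "bisection \<G> (restrict_src (B i) V)"
    by (rule bisection_restrict_src[OF bisection_familyD(1)[OF assms(1) i] assms(2)])
  show "src \<G> ` restrict_src (B i) V = V"
    unfolding src_image_restrict_src using bisection_familyD(2)[OF assms(1) i] assms(3) by blast
  fix j assume "j \<in> I" "i \<noteq> j"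
  then have "rng \<G> ` B i \<inter> rng \<G> ` B j = {}"
    using assms(1) i unfolding bisection_family_def by blast
  then show "rng \<G> ` restrict_src (B i) V \<inter> rng \<G> ` restrict_src (B j) V = {}"
    using restrict_src_subset[of "B i" V] restrict_src_subset[of "B j" V] by blast
qed

lemma realizes_moves:
  "\<lbrakk>realizes I B \<sigma> g; i \<in> I; b \<in> B i; c \<in> B (\<sigma> i); src \<G> b = src \<G> c\<rbrakk> \<Longrightarrow> act g (rng \<G> b) = rng \<G> c"
  unfolding realizes_def by blast

lemma realizes_fixes:
  "\<lbrakk>realizes I B \<sigma> g; x \<in> units \<G>; \<And>i. i \<in> I \<Longrightarrow> x \<notin> rng \<G> ` B i\<rbrakk> \<Longrightarrow> act g x = x"
  unfolding realizes_def by blast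

lemma realizes_fixes_index:
  "\<lbrakk>realizes I B \<sigma> g; i \<in> I; \<sigma> i = i; b \<in> B i\<rbrakk> \<Longrightarrow> act g (rng \<G> b) = rng \<G> b"
  using realizes_moves by metis

lemma realizes_reindex:
  assumes "realizes (p ` I) B \<sigma> g" "\<And>i. i \<in> I \<Longrightarrow> \<sigma> (p i) = p (\<tau> i)"
  shows "realizes I (\<lambda>i. B (p i)) \<tau> g"
  using assms unfolding realizes_def by simp

text \<open>Ranges over indices outside \<open>J\<close> miss those over \<open>J\<close>, so
  \<open>g\<close> is the identity there. This brings cycles on different triples to one index set,
  where their products can be formed.\<close>

lemma realizes_extend:
  assumes g: "realizes J B \<sigma> g" and B: "bisection_family I B W" and J: "J \<subseteq> I"
    and out: "\<And>i. i \<in> I - J \<Longrightarrow> \<sigma> i = i"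
  shows "realizes I B \<sigma> g"
  unfolding realizes_def
proof (intro conjI ballI impI)
  fix i b c assume *: "i \<in> I" "b \<in> B i" "c \<in> B (\<sigma> i)" "src \<G> b = src \<G> c"
  show "act g (rng \<G> b) = rng \<G> c"
  proof (cases "i \<in> J")
    case True
    then show ?thesis using realizes_moves[OF g] * by blast
  next
    case False
    then have "\<sigma> i = i" using out * by blast
    then have "b = c" using * inj_onD[OF bisection_inj_src[OF bisection_familyD(1)[OF B]]] by metis
    moreover have "act g (rng \<G> b) = rng \<G> b"
    proof (rule realizes_fixes[OF g])
      show "rng \<G> b \<in> units \<G>"
        by (rule rng_in_units[OF bisection_arrow[OF bisection_familyD(1)[OF B]]]) (use * in auto)
      show "rng \<G> b \<notin> rng \<G> ` B j" if "j \<in> J" for j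
        using bisection_family_disjoint[OF B \<open>i \<in> I\<close> _ \<open>b \<in> B i\<close>] False that J by blast
    qed
    ultimately show ?thesis by simp
  qed
next
  fix x assume "x \<in> units \<G>" "\<forall>i\<in>I. x \<notin> rng \<G> ` B i"
  then show "act g x = x" using realizes_fixes[OF g] J by blast
qed

text \<open>Each factor preserves the parameter in \<open>W\<close>. The common source set supplies
  the intermediate arrow \<open>d\<close>, and the product turns into the composition of index
  maps.\<close>

lemma realizes_mult:
  assumes B: "bisection_family I B W"
    and g: "g \<in> carrier (full_group \<G>)" "g' \<in> carrier (full_group \<G>)"
    and r: "realizes I B \<sigma> g" "realizes I B \<sigma>' g'"
    and \<sigma>': "\<sigma>' ` I \<subseteq> I"
  shows "realizes I B (\<sigma> \<circ> \<sigma>') (g \<otimes>\<^bsub>full_group \<G>\<^esub> g')"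
  unfolding realizes_def
proof (intro conjI ballI impI)
  fix i b c assume *: "i \<in> I" "b \<in> B i" "c \<in> B ((\<sigma> \<circ> \<sigma>') i)" "src \<G> b = src \<G> c"
  then have i': "\<sigma>' i \<in> I" using \<sigma>' by blast
  have "src \<G> b \<in> src \<G> ` B (\<sigma>' i)"
    using bisection_familyD(2)[OF B i'] bisection_familyD(2)[OF B *(1)] *(2) by blast
  then obtain d where d: "d \<in> B (\<sigma>' i)" "src \<G> b = src \<G> d" by blast
  have u: "rng \<G> b \<in> units \<G>"
    by (rule rng_in_units[OF bisection_arrow[OF bisection_familyD(1)[OF B *(1)] *(2)]])
  have "act g' (rng \<G> b) = rng \<G> d" using realizes_moves[OF r(2)] * d by blast
  moreover have "act g (rng \<G> d) = rng \<G> c" using realizes_moves[OF r(1) i'] * d by simp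
  ultimately show "act (g \<otimes>\<^bsub>full_group \<G>\<^esub> g') (rng \<G> b) = rng \<G> c"
    using act_mult[OF g u] by simp
next
  fix x assume "x \<in> units \<G>" "\<forall>i\<in>I. x \<notin> rng \<G> ` B i"
  then show "act (g \<otimes>\<^bsub>full_group \<G>\<^esub> g') x = x"
    using act_mult[OF g] realizes_fixes[OF r(1)] realizes_fixes[OF r(2)] by simp
qed

text \<open>The products \<open>B j (B i)\<^sup>-\<^sup>1\<close> over the three indices form a
  multisection of degree 3; the element belonging to the even permutation
  \<open>cycle3 1 2 3\<close> is the one wanted.\<close>

lemma three_cycle_exists:
  assumes B: "bisection_family I B W" and abc: "a \<in> I" "b \<in> I" "c \<in> I" "a \<noteq> b" "b \<noteq> c" "a \<noteq> c"
  obtains g where "g \<in> alternating_full_group \<G>" "realizes I B (cycle3 a b c) g"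
proof -
  \<comment> \<open>The value \<open>c\<close> at all arguments other than 1 and 2 makes
    \<open>p i \<in> I\<close> hold for every \<open>i\<close>.\<close>
  define p where "p i = (if i = 1 then a else if i = 2 then b else c)" for i :: nat
  have set3: "{1..3} = {1, 2, 3::nat}" by auto
  have pI: "p i \<in> I" for i using abc unfolding p_def by simp
  have pinj: "p i \<noteq> p j" if "i \<in> {1..3}" "j \<in> {1..3}" "i \<noteq> j" for i j
    using that abc unfolding set3 p_def by auto
  define F where "F i j = set_gmult \<G> (B (p j)) (ginv \<G> ` B (p i))" for i j
  have bis: "bisection \<G> (B (p i))" and sW: "src \<G> ` B (p i) = W" for i
    using bisection_familyD[OF B pI] by auto
  have sub: "B (p i) \<subseteq> arrows \<G>" "ginv \<G> ` B (p i) \<subseteq> arrows \<G>" for i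
    using bisection_subset bis bisection_ginv by auto
  have Fii: "F i i = rng \<G> ` B (p i)" for i
    unfolding F_def by (rule set_gmult_ginv_right[OF sub(1) bisection_inj_src[OF bis]])
  have mult: "set_gmult \<G> (F j k) (F i j) = F i k" for i j k
  proof -
    have s: "set_gmult \<G> (B (p j)) (ginv \<G> ` B (p i)) \<subseteq> arrows \<G>"
      by (rule bisection_subset[OF bisection_set_gmult[OF bis bisection_ginv[OF bis]]])
    have "set_gmult \<G> (F j k) (F i j) = set_gmult \<G> (B (p k))
        (set_gmult \<G> (ginv \<G> ` B (p j)) (set_gmult \<G> (B (p j)) (ginv \<G> ` B (p i))))"
      unfolding F_def by (rule set_gmult_assoc[OF sub(1,2) s])
    also have "set_gmult \<G> (ginv \<G> ` B (p j)) (set_gmult \<G> (B (p j)) (ginv \<G> ` B (p i)))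
        = set_gmult \<G> (src \<G> ` B (p j)) (ginv \<G> ` B (p i))"
      using set_gmult_assoc[OF sub(2,1,2)]
        set_gmult_ginv_left[OF sub(1) bisection_inj_rng[OF bis]] by metis
    \<comment> \<open>All source sets agree, so the middle factor can be read as that of
      \<open>B (p k)\<close> and absorbed into \<open>B (p k)\<close>.\<close>
    also have "src \<G> ` B (p j) = src \<G> ` B (p k)" using sW by simp
    also have "set_gmult \<G> (B (p k)) (set_gmult \<G> (src \<G> ` B (p k)) (ginv \<G> ` B (p i)))
        = set_gmult \<G> (set_gmult \<G> (B (p k)) (src \<G> ` B (p k))) (ginv \<G> ` B (p i))"
      by (rule set_gmult_assoc[OF sub(1) _ sub(2), symmetric]) (use sub(1) src_closed in blast)
    also have "\<dots> = F i k" unfolding F_def using set_gmult_image_src_right[OF sub(1)] by simp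
    finally show ?thesis .
  qed
  have ms: "multisection \<G> 3 F"
    unfolding multisection_def
  proof (intro conjI ballI impI)
    fix i j :: nat assume ij: "i \<in> {1..3}" "j \<in> {1..3}"
    show "bisection \<G> (F i j)"
      unfolding F_def by (rule bisection_set_gmult[OF bis bisection_ginv[OF bis]])
    show "F i i \<inter> F j j = {}" if "i \<noteq> j"
      unfolding Fii using B pI pinj[OF ij that] unfolding bisection_family_def by blast
  next
    fix i :: nat
    show "F i i \<subseteq> units \<G>" unfolding Fii using sub(1) rng_in_units by blast
  qed (rule mult)
  define \<pi> where "\<pi> = cycle3 1 2 (3::nat)"
  have \<pi>: "\<pi> permutes {1..3}" "evenperm \<pi>"
    unfolding \<pi>_def by (auto intro!: cycle3_permutes evenperm_cycle3)
  have p\<pi>: "p (\<pi> i) = cycle3 a b c (p i)" if "i \<in> {1..3}" for i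
    using that abc unfolding set3 p_def \<pi>_def cycle3_def by auto
  have out: "cycle3 a b c i = i" if "i \<notin> p ` {1..3}" for i
    using that unfolding set3 p_def cycle3_def by auto
  let ?g = "multisection_perm \<G> 3 F \<pi>"
  have "?g \<in> multisection_alt \<G> 3 F" unfolding multisection_alt_def using \<pi> by blast
  then have gA: "?g \<in> alternating_full_group \<G>"
    unfolding alternating_full_group_def using ms by (auto intro!: generate.incl)
  have "realizes (p ` {1..3}) B (cycle3 a b c) ?g"
    unfolding realizes_def
  proof (intro conjI ballI impI)
    fix i x y assume *: "i \<in> p ` {1..3}" "x \<in> B i" "y \<in> B (cycle3 a b c i)" "src \<G> x = src \<G> y"
    then obtain m where m: "m \<in> {1..3}" "i = p m" by blast
    have ar: "x \<in> arrows \<G>" "y \<in> arrows \<G>" using * m sub(1)[of m] sub(1)[of "\<pi> m"] p\<pi>[OF m(1)] by auto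
    have sm: "src \<G> y = rng \<G> (ginv \<G> x)" using * ar rng_ginv by simp
    have "gmult \<G> y (ginv \<G> x) \<in> F m (\<pi> m)"
      unfolding F_def using sm * m p\<pi>[OF m(1)] by (auto intro!: set_gmultI)
    then have "act ?g (src \<G> (gmult \<G> y (ginv \<G> x))) = rng \<G> (gmult \<G> y (ginv \<G> x))"
      by (rule act_multisection_perm(1)[OF ms \<pi>(1) m(1)])
    then show "act ?g (rng \<G> x) = rng \<G> y"
      using src_gmult[of y "ginv \<G> x"] rng_gmult[of y "ginv \<G> x"] ar sm ginv_closed src_ginv by simp
  next
    fix x assume "x \<in> units \<G>" "\<forall>i\<in>p ` {1..3}. x \<notin> rng \<G> ` B i"
    then show "act ?g x = x" using act_multisection_perm(2)[OF ms \<pi>(1)] Fii by blast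
  qed
  then have "realizes I B (cycle3 a b c) ?g"
    by (rule realizes_extend[OF _ B]) (use pI out in auto)
  then show ?thesis using that gA by blast
qed

text \<open>Conversely, the entries leaving index 1 have the common source set \<open>F 1 1\<close>,
  and their ranges are the disjoint diagonal sets.\<close>

lemma multisection_family:
  assumes F: "multisection \<G> d F" and "1 \<le> d"
  shows "bisection_family {1..d} (F 1) (F 1 1)"
proof -
  have one: "1 \<in> {1..d}" using assms(2) by simp
  have "bisection \<G> (F 1 i)" if "i \<in> {1..d}" for i
    using F one that unfolding multisection_def by blast
  moreover have "F i i \<inter> F j j = {}" if "i \<in> {1..d}" "j \<in> {1..d}" "i \<noteq> j" for i j
    using F that unfolding multisection_def by blast
  ultimately show ?thesis
    unfolding bisection_family_def using multisection_src_rng[OF F one] by simp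
qed

text \<open>Prolong \<open>b\<close> by the arrow \<open>e\<close> of \<open>F i (\<pi> i)\<close>
  that starts at the range of \<open>b\<close>. The product lies in \<open>F 1 (\<pi> i)\<close> and
  has the source of \<open>c\<close>, so it is \<open>c\<close>, and \<open>e\<close> ends where
  \<open>c\<close> does.\<close>

lemma realizes_multisection_perm:
  assumes F: "multisection \<G> d F" and "1 \<le> d" and p: "\<pi> permutes {1..d}"
  shows "realizes {1..d} (F 1) \<pi> (multisection_perm \<G> d F \<pi>)"
  unfolding realizes_def
proof (intro conjI ballI impI)
  fix i b c assume *: "i \<in> {1..d}" "b \<in> F 1 i" "c \<in> F 1 (\<pi> i)" "src \<G> b = src \<G> c"
  have one: "1 \<in> {1..d}" using assms(2) by simp
  have i': "\<pi> i \<in> {1..d}" using * p permutes_in_image by metis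
  have bis: "bisection \<G> (F 1 i)" "bisection \<G> (F i (\<pi> i))" "bisection \<G> (F 1 (\<pi> i))"
    and m: "set_gmult \<G> (F i (\<pi> i)) (F 1 i) = F 1 (\<pi> i)"
    using F * i' one unfolding multisection_def by auto
  have "rng \<G> b \<in> src \<G> ` F i (\<pi> i)"
    using multisection_src_rng(1)[OF F *(1) i'] multisection_src_rng(2)[OF F one *(1)] *(2) by blast
  then obtain e where e: "e \<in> F i (\<pi> i)" "src \<G> e = rng \<G> b" by auto
  have ar: "e \<in> arrows \<G>" "b \<in> arrows \<G>" using bisection_arrow bis e * by auto
  have "gmult \<G> e b \<in> F 1 (\<pi> i)" using m e * set_gmultI by metis
  moreover have "src \<G> (gmult \<G> e b) = src \<G> c" using src_gmult ar e * by simp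
  ultimately have "gmult \<G> e b = c" using * inj_onD[OF bisection_inj_src[OF bis(3)]] by blast
  then have "rng \<G> e = rng \<G> c" using rng_gmult ar e by metis
  then show "act (multisection_perm \<G> d F \<pi>) (rng \<G> b) = rng \<G> c"
    using act_multisection_perm(1)[OF F p *(1) e(1)] e(2) by simp
next
  fix x assume x: "x \<in> units \<G>" "\<forall>i\<in>{1..d}. x \<notin> rng \<G> ` F 1 i"
  have one: "1 \<in> {1..d}" using assms(2) by simp
  show "act (multisection_perm \<G> d F \<pi>) x = x"
    by (rule act_multisection_perm(2)[OF F p x(1)]) (use x multisection_src_rng(2)[OF F one] in blast)
qed

end

section \<open>Minimal groupoids of germs\<close>

locale minimal_germ_groupoid = ample_groupoid +
  assumes perfect: "x \<in> units \<G> \<Longrightarrow> \<not> openin (unit_space \<G>) {x}"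
    and minimal: "minimal_groupoid \<G>"
    and germs: "groupoid_of_germs \<G>"
begin

text \<open>Under a trivial action every arrow of \<open>F\<close> has equal source and range, so a
  non-unit in \<open>F\<close> would contradict the germ condition for \<open>F\<close> itself. A
  set of units whose sources exhaust the units is the whole unit space.\<close>

lemma full_group_trivial:
  assumes F: "F \<in> carrier (full_group \<G>)" and id: "\<And>x. x \<in> units \<G> \<Longrightarrow> act F x = x"
  shows "F = units \<G>"
proof -
  have bis: "bisection \<G> F" by (rule full_group_bisection[OF F])
  have sr: "src \<G> a = rng \<G> a" if "a \<in> F" for a
    using act_src[OF F that] id[OF src_in_units[OF bisection_arrow[OF bis that]]] by simp
  have sub: "F \<subseteq> units \<G>"
  proof (rule subsetI, rule ccontr)
    fix a assume "a \<in> F" "a \<notin> units \<G>"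
    then obtain b where "b \<in> F" "src \<G> b \<noteq> rng \<G> b"
      using germs bis bisection_arrow unfolding groupoid_of_germs_def by blast
    then show False using sr by blast
  qed
  have "x \<in> F" if "x \<in> units \<G>" for x
  proof -
    have "x \<in> src \<G> ` F" using F that full_group_carrier by simp
    then show ?thesis using sub src_unit by auto
  qed
  then show ?thesis using sub by blast
qed

lemma full_group_eqI:
  assumes F: "F \<in> carrier (full_group \<G>)" "F' \<in> carrier (full_group \<G>)"
    and eq: "\<And>x. x \<in> units \<G> \<Longrightarrow> act F x = act F' x"
  shows "F = F'"
proof -
  interpret K: group "full_group \<G>" by (rule group_full_group)
  have "inv\<^bsub>full_group \<G>\<^esub> F' \<otimes>\<^bsub>full_group \<G>\<^esub> F = units \<G>"
    by (rule full_group_trivial) (use F eq act_mult act_inv in auto)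
  then have "inv\<^bsub>full_group \<G>\<^esub> F' \<otimes>\<^bsub>full_group \<G>\<^esub> F = \<one>\<^bsub>full_group \<G>\<^esub>"
    using full_group_one by simp
  then have "inv\<^bsub>full_group \<G>\<^esub> F = inv\<^bsub>full_group \<G>\<^esub> F'" using F K.inv_equality by simp
  then show ?thesis using F K.inv_inv by metis
qed

text \<open>The action on the ranges of the family is dictated by the index map, and elsewhere it is
  trivial; effectiveness does the rest. Identities in the full group thus reduce to checks on
  indices.\<close>

lemma realizes_unique:
  assumes B: "bisection_family I B W"
    and g: "g \<in> carrier (full_group \<G>)" "g' \<in> carrier (full_group \<G>)"
    and r: "realizes I B \<sigma> g" "realizes I B \<sigma>' g'"
    and \<sigma>: "\<And>i. i \<in> I \<Longrightarrow> \<sigma> i \<in> I" "\<And>i. i \<in> I \<Longrightarrow> \<sigma> i = \<sigma>' i"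
  shows "g = g'"
proof (rule full_group_eqI[OF g])
  fix x assume x: "x \<in> units \<G>"
  show "act g x = act g' x"
  proof (cases "\<exists>i\<in>I. x \<in> rng \<G> ` B i")
    case True
    then obtain i b where ib: "i \<in> I" "b \<in> B i" "x = rng \<G> b" by blast
    have "src \<G> b \<in> src \<G> ` B (\<sigma> i)"
      using bisection_familyD(2)[OF B \<sigma>(1)[OF ib(1)]] bisection_familyD(2)[OF B ib(1)] ib(2) by blast
    then obtain c where c: "c \<in> B (\<sigma> i)" "src \<G> b = src \<G> c" by blast
    then have "act g x = rng \<G> c" using realizes_moves[OF r(1)] ib by blast
    moreover have "act g' x = rng \<G> c" using realizes_moves[OF r(2)] ib c \<sigma>(2)[OF ib(1)] by simp
    ultimately show ?thesis by simp
  next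
    case False
    then show ?thesis using realizes_fixes[OF r(1) x] realizes_fixes[OF r(2) x] by metis
  qed
qed

text \<open>All points but one of a finite open set form a closed set, as the unit space is
  Hausdorff; the remaining point would be isolated.\<close>

lemma infinite_open:
  assumes U: "openin (unit_space \<G>) U" "U \<noteq> {}"
  shows "infinite U"
proof
  assume fin: "finite U"
  obtain x where x: "x \<in> U" using U by blast
  have sub: "U \<subseteq> topspace (unit_space \<G>)" using U openin_subset by blast
  have "closedin (unit_space \<G>) (U - {x})"
    using closedin_Hausdorff_finite[OF Hausdorff_units, of "U - {x}"] fin sub by auto
  then have "openin (unit_space \<G>) (U - (U - {x}))" using U openin_diff by blast
  moreover have "U - (U - {x}) = {x}" using x by blast
  ultimately show False using perfect x sub topspace_unit_space by auto
qed

text \<open>If the orbit met \<open>U\<close> in a finite set, removing this closed set from the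
  infinite \<open>U\<close> would leave a non-empty open set missed by a dense orbit.\<close>

lemma infinite_orbit_Int:
  assumes x: "x \<in> units \<G>" and U: "openin (unit_space \<G>) U" "U \<noteq> {}"
  shows "infinite (orbit_of \<G> x \<inter> U)"
proof
  assume fin: "finite (orbit_of \<G> x \<inter> U)"
  have sub: "U \<subseteq> topspace (unit_space \<G>)" using U openin_subset by blast
  have "closedin (unit_space \<G>) (orbit_of \<G> x \<inter> U)"
    using closedin_Hausdorff_finite[OF Hausdorff_units _ fin] sub by auto
  then have op: "openin (unit_space \<G>) (U - (orbit_of \<G> x \<inter> U))" using U openin_diff by blast
  have "U - (orbit_of \<G> x \<inter> U) \<noteq> {}"
    using infinite_open[OF U] fin by (metis Diff_eq_empty_iff finite_subset)
  then obtain y where y: "y \<in> U - (orbit_of \<G> x \<inter> U)" by blast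
  then have "y \<in> Abstract_Topology.closure_of (unit_space \<G>) (orbit_of \<G> x)"
    using minimal x sub topspace_unit_space unfolding minimal_groupoid_def by auto
  then obtain z where "z \<in> orbit_of \<G> x" "z \<in> U - (orbit_of \<G> x \<inter> U)"
    using op y by (metis in_closure_of)
  then show False by blast
qed

end

lemma cycle3_closed: "\<lbrakk>a \<in> I; b \<in> I; c \<in> I\<rbrakk> \<Longrightarrow> cycle3 a b c ` I \<subseteq> I"
  by (auto simp: cycle3_def)

text \<open>Closure under conjugation gives one inclusion; applied to \<open>inv a\<close>, again in
  \<open>A\<close>, it gives the other.\<close>

lemma (in group) normalized_byI:
  assumes A: "subgroup A G" and N: "subgroup N G"
    and conj: "\<And>a x. \<lbrakk>a \<in> A; x \<in> N\<rbrakk> \<Longrightarrow> a \<otimes> x \<otimes> inv a \<in> N"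
  shows "normalized_by G N A"
  unfolding normalized_by_def
proof
  fix a assume a: "a \<in> A"
  have ac: "a \<in> carrier G" by (rule subgroup.mem_carrier[OF A a])
  show "a <# N #> inv a = N"
  proof (intro equalityI subsetI)
    fix y assume "y \<in> a <# N #> inv a"
    then obtain x where "x \<in> N" "y = a \<otimes> x \<otimes> inv a"
      unfolding l_coset_def r_coset_def by blast
    then show "y \<in> N" using conj a by blast
  next
    fix y assume y: "y \<in> N"
    have yc: "y \<in> carrier G" by (rule subgroup.mem_carrier[OF N y])
    have "inv a \<otimes> y \<otimes> inv (inv a) \<in> N"
      using conj subgroup.m_inv_closed[OF A a] y by blast
    then have "inv a \<otimes> y \<otimes> a \<in> N" using ac by simp
    moreover have "a \<otimes> (inv a \<otimes> y) = y"
      using ac yc by (simp add: m_assoc[symmetric])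
    then have "y = a \<otimes> (inv a \<otimes> y \<otimes> a) \<otimes> inv a"
      using ac yc by (simp add: m_assoc)
    ultimately show "y \<in> a <# N #> inv a"
      unfolding l_coset_def r_coset_def by blast
  qed
qed

lemma (in group) normalized_byD:
  assumes "normalized_by G N A" "a \<in> A" "x \<in> N"
  shows "a \<otimes> x \<otimes> inv a \<in> N"
  using assms unfolding normalized_by_def l_coset_def r_coset_def by blast

section \<open>Localizing families of bisections\<close>

context ample_groupoid
begin

lemma realizes_cong:
  assumes "realizes I B \<sigma> g" "\<And>i. i \<in> I \<Longrightarrow> B' i = B i" "\<sigma> ` I \<subseteq> I"
  shows "realizes I B' \<sigma> g"
  using assms unfolding realizes_def by (simp add: image_subset_iff)

text \<open>Disjoint ranges and injectivity of \<open>rng\<close> make \<open>b\<close> the only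
  arrow of the family ending at \<open>rng \<G> b\<close>. Its source is outside \<open>V\<close>,
  so no restricted bisection reaches this unit.\<close>

lemma realizes_restrict_fixes:
  assumes B: "bisection_family I B W" and g: "realizes I (\<lambda>i. restrict_src (B i) V) \<sigma> g"
    and b: "i \<in> I" "b \<in> B i" "src \<G> b \<notin> V"
  shows "act g (rng \<G> b) = rng \<G> b"
proof (rule realizes_fixes[OF g])
  show "rng \<G> b \<in> units \<G>"
    by (rule rng_in_units[OF bisection_arrow[OF bisection_familyD(1)[OF B b(1)] b(2)]])
  fix j assume j: "j \<in> I"
  show "rng \<G> b \<notin> rng \<G> ` restrict_src (B j) V"
  proof
    assume "rng \<G> b \<in> rng \<G> ` restrict_src (B j) V"
    then obtain d where d: "d \<in> B j" "src \<G> d \<in> V" "rng \<G> b = rng \<G> d"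
      unfolding restrict_src_def by blast
    have "i = j" by (rule bisection_family_disjoint[OF B b(1) j b(2) d(1,3)])
    then have "b = d"
      using inj_onD[OF bisection_inj_rng[OF bisection_familyD(1)[OF B b(1)]] d(3) b(2)] d(1) by blast
    then show False using b(3) d(2) by simp
  qed
qed

text \<open>Both factors preserve the parameter in \<open>W\<close>, so each acts on the units over
  its own piece and fixes those over the other, also after the other factor has acted.\<close>

lemma realizes_split:
  assumes B: "bisection_family I B W" and \<sigma>: "\<sigma> ` I \<subseteq> I"
    and g: "g1 \<in> carrier (full_group \<G>)" "g2 \<in> carrier (full_group \<G>)"
    and r: "realizes I (\<lambda>i. restrict_src (B i) V1) \<sigma> g1" "realizes I (\<lambda>i. restrict_src (B i) V2) \<sigma> g2"
    and disj: "V1 \<inter> V2 = {}"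
  shows "realizes I (\<lambda>i. restrict_src (B i) (V1 \<union> V2)) \<sigma> (g1 \<otimes>\<^bsub>full_group \<G>\<^esub> g2)"
  unfolding realizes_def
proof (intro conjI ballI impI)
  fix i b c assume *: "i \<in> I" "b \<in> restrict_src (B i) (V1 \<union> V2)"
    "c \<in> restrict_src (B (\<sigma> i)) (V1 \<union> V2)" "src \<G> b = src \<G> c"
  then have b: "b \<in> B i" and c: "c \<in> B (\<sigma> i)" and i': "\<sigma> i \<in> I" and V: "src \<G> b \<in> V1 \<union> V2"
    using \<sigma> unfolding restrict_src_def by auto
  have u: "rng \<G> b \<in> units \<G>"
    by (rule rng_in_units[OF bisection_arrow[OF bisection_familyD(1)[OF B *(1)] b]])
  show "act (g1 \<otimes>\<^bsub>full_group \<G>\<^esub> g2) (rng \<G> b) = rng \<G> c"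
  proof (cases "src \<G> b \<in> V1")
    case True
    then have "src \<G> b \<notin> V2" using disj by blast
    then have "act g2 (rng \<G> b) = rng \<G> b" by (rule realizes_restrict_fixes[OF B r(2) *(1) b])
    moreover have "act g1 (rng \<G> b) = rng \<G> c"
      by (rule realizes_moves[OF r(1) *(1)]) (use b c True *(4) in \<open>auto simp: restrict_src_def\<close>)
    ultimately show ?thesis using act_mult[OF g u] by simp
  next
    case False
    then have "act g2 (rng \<G> b) = rng \<G> c"
      by (intro realizes_moves[OF r(2) *(1)]) (use b c V *(4) in \<open>auto simp: restrict_src_def\<close>)
    moreover have "act g1 (rng \<G> c) = rng \<G> c"
      by (rule realizes_restrict_fixes[OF B r(1) i' c]) (use False *(4) in simp)
    ultimately show ?thesis using act_mult[OF g u] by simp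
  qed
next
  fix x assume x: "x \<in> units \<G>" "\<forall>i\<in>I. x \<notin> rng \<G> ` restrict_src (B i) (V1 \<union> V2)"
  have "act g1 x = x" by (rule realizes_fixes[OF r(1) x(1)]) (use x(2) in \<open>auto simp: restrict_src_def\<close>)
  moreover have "act g2 x = x"
    by (rule realizes_fixes[OF r(2) x(1)]) (use x(2) in \<open>auto simp: restrict_src_def\<close>)
  ultimately show "act (g1 \<otimes>\<^bsub>full_group \<G>\<^esub> g2) x = x" using act_mult[OF g x(1)] by simp
qed

text \<open>Disjoint neighbourhoods of the distinct ranges keep the thickened arrows apart, and the
  intersection of their finitely many source sets is the common \<open>W\<close>. The sets
  \<open>S i\<close> prescribe where the thickening has to stay.\<close>

lemma family_around:
  assumes I: "finite I" "I \<noteq> {}"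
    and c: "\<And>i. i \<in> I \<Longrightarrow> c i \<in> S i \<and> openin (gtop \<G>) (S i) \<and> src \<G> (c i) = x"
    and inj: "inj_on (\<lambda>i. rng \<G> (c i)) I"
  obtains C W where "clopen W" "x \<in> W" "bisection_family I C W" "\<And>i. i \<in> I \<Longrightarrow> c i \<in> C i \<and> C i \<subseteq> S i"
proof -
  let ?P = "(\<lambda>i. rng \<G> (c i)) ` I"
  have car: "c i \<in> arrows \<G>" if "i \<in> I" for i using c[OF that] openin_subset by blast
  have "finite ?P" "?P \<subseteq> topspace (unit_space \<G>)"
    using I(1) car rng_in_units topspace_unit_space by auto
  then obtain V where V: "\<And>y. y \<in> ?P \<Longrightarrow> openin (unit_space \<G>) (V y) \<and> y \<in> V y"
    "\<And>y z. \<lbrakk>y \<in> ?P; z \<in> ?P; y \<noteq> z\<rbrakk> \<Longrightarrow> V y \<inter> V z = {}"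
    using Hausdorff_space_separate_finite[OF Hausdorff_units] by metis
  have "\<exists>C. bisection \<G> C \<and> c i \<in> C \<and> C \<subseteq> S i \<and> rng \<G> ` C \<subseteq> V (rng \<G> (c i))" if i: "i \<in> I" for i
  proof -
    have "openin (gtop \<G>) {a \<in> arrows \<G>. rng \<G> a \<in> V (rng \<G> (c i))}"
      using openin_continuous_map_preimage[OF continuous_rng] V(1) i by blast
    then have "openin (gtop \<G>) (S i \<inter> {a \<in> arrows \<G>. rng \<G> a \<in> V (rng \<G> (c i))})"
      using c[OF i] by blast
    moreover have "c i \<in> S i \<inter> {a \<in> arrows \<G>. rng \<G> a \<in> V (rng \<G> (c i))}"
      using c[OF i] car[OF i] V(1) i by blast
    ultimately obtain C where "bisection \<G> C" "c i \<in> C"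
      "C \<subseteq> S i \<inter> {a \<in> arrows \<G>. rng \<G> a \<in> V (rng \<G> (c i))}"
      by (rule bisection_nhd)
    then show ?thesis by blast
  qed
  then obtain C where C: "\<And>i. i \<in> I \<Longrightarrow> bisection \<G> (C i) \<and> c i \<in> C i \<and> C i \<subseteq> S i \<and>
      rng \<G> ` C i \<subseteq> V (rng \<G> (c i))"
    by metis
  define W where "W = (\<Inter>i\<in>I. src \<G> ` C i)"
  have W: "clopen W"
    unfolding clopen_def W_def
    using I C src_image_open src_image_closed by (auto intro!: openin_Inter closedin_Inter)
  show ?thesis
  proof (rule that[of W "\<lambda>i. restrict_src (C i) W"])
    show "clopen W" by (rule W)
    show xW: "x \<in> W"
      unfolding W_def
    proof (rule INT_I)
      fix i assume i: "i \<in> I"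
      show "x \<in> src \<G> ` C i" using c[OF i] C[OF i] by (metis imageI)
    qed
    show "c i \<in> restrict_src (C i) W \<and> restrict_src (C i) W \<subseteq> S i" if "i \<in> I" for i
      using c[OF that] C[OF that] xW restrict_src_subset[of "C i" W] unfolding restrict_src_def by auto
    show "bisection_family I (\<lambda>i. restrict_src (C i) W) W"
      unfolding bisection_family_def
    proof (intro conjI ballI impI)
      fix i assume i: "i \<in> I"
      show "bisection \<G> (restrict_src (C i) W)" using bisection_restrict_src C[OF i] W by blast
      show "src \<G> ` restrict_src (C i) W = W"
        unfolding src_image_restrict_src using i W_def by blast
      fix j assume j: "j \<in> I" "i \<noteq> j"
      have "rng \<G> (c i) \<noteq> rng \<G> (c j)" using inj i j by (auto dest: inj_onD)
      then have "V (rng \<G> (c i)) \<inter> V (rng \<G> (c j)) = {}" using V(2) i j by blast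
      moreover have "rng \<G> ` restrict_src (C i) W \<subseteq> V (rng \<G> (c i))"
        "rng \<G> ` restrict_src (C j) W \<subseteq> V (rng \<G> (c j))"
        using C[OF i] C[OF j(1)] restrict_src_subset by blast+
      ultimately show "rng \<G> ` restrict_src (C i) W \<inter> rng \<G> ` restrict_src (C j) W = {}" by blast
    qed
  qed
qed

lemma bisection_family_clopen: "\<lbrakk>bisection_family I B W; i \<in> I\<rbrakk> \<Longrightarrow> clopen W"
  using clopen_src_image bisection_familyD by metis

end

section \<open>Elements and displaced sets in the minimal effective case\<close>

context minimal_germ_groupoid
begin

text \<open>The finite set \<open>P\<close> keeps the new ranges away from units already in use; an
  injective sequence allows any number of arrows to be taken by index.\<close>

lemma orbit_arrows:
  assumes x: "x \<in> units \<G>" and U: "openin (unit_space \<G>) U" "U \<noteq> {}" and P: "finite P"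
  obtains e :: "nat \<Rightarrow> 'a" where
    "\<And>n. e n \<in> arrows \<G> \<and> src \<G> (e n) = x \<and> rng \<G> (e n) \<in> U - P" "inj (\<lambda>n. rng \<G> (e n))"
proof -
  have "infinite (orbit_of \<G> x \<inter> U - P)" using infinite_orbit_Int[OF x U] P by simp
  then obtain f :: "nat \<Rightarrow> 'a" where f: "inj f" "range f \<subseteq> orbit_of \<G> x \<inter> U - P"
    using infinite_countable_subset by metis
  have "\<exists>a. a \<in> arrows \<G> \<and> src \<G> a = x \<and> rng \<G> a = f n" for n
  proof -
    have "f n \<in> orbit_of \<G> x" using f(2) by blast
    then show ?thesis unfolding orbit_of_def by auto
  qed
  then obtain e where e: "\<And>n. e n \<in> arrows \<G> \<and> src \<G> (e n) = x \<and> rng \<G> (e n) = f n" by metis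
  show ?thesis by (rule that[of e]) (use e f in auto)
qed

text \<open>If \<open>k\<close> moves \<open>x\<close>, injectivity shows that \<open>k\<close>
  moves \<open>act k x\<close> as well, so \<open>k'\<close> fixes both units and the two orders
  agree at \<open>x\<close>.\<close>

lemma disjoint_support_commute:
  assumes g: "g \<in> carrier (full_group \<G>)" "g' \<in> carrier (full_group \<G>)"
    and disj: "\<And>x. x \<in> units \<G> \<Longrightarrow> act g x = x \<or> act g' x = x"
  shows "g \<otimes>\<^bsub>full_group \<G>\<^esub> g' = g' \<otimes>\<^bsub>full_group \<G>\<^esub> g"
proof -
  interpret K: group "full_group \<G>" by (rule group_full_group)
  have "act k (act k' x) = act k' (act k x)"
    if "k \<in> carrier (full_group \<G>)" "x \<in> units \<G>" "act k x \<noteq> x"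
      "\<And>x. x \<in> units \<G> \<Longrightarrow> act k x = x \<or> act k' x = x" for k k' x
  proof -
    have u: "act k x \<in> units \<G>" using act_in_units that by blast
    have "act k (act k x) \<noteq> act k x" using act_inj[OF that(1) u that(2)] that(3) by blast
    then show ?thesis using that(4)[OF u] that(4)[OF that(2)] that(3) by simp
  qed
  from this[of g _ g'] this[of g' _ g]
  have "act g (act g' x) = act g' (act g x)" if "x \<in> units \<G>" for x
    using that g disj by metis
  then show ?thesis
    using g act_mult K.m_closed by (intro full_group_eqI) simp_all
qed

text \<open>Separate a moved unit from its image by disjoint open sets \<open>A\<close> and
  \<open>B\<close>. The units of \<open>A\<close> that \<open>g\<close> sends into \<open>B\<close>
  form an open set that contains the moved unit and misses its own image.\<close>

lemma displaced_open_set: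
  assumes g: "g \<in> carrier (full_group \<G>)" "g \<noteq> units \<G>"
  obtains U where "openin (unit_space \<G>) U" "U \<noteq> {}" "\<And>x. x \<in> U \<Longrightarrow> act g x \<notin> U"
proof -
  obtain x where x: "x \<in> units \<G>" "act g x \<noteq> x" using full_group_trivial g by blast
  then obtain A B where AB: "openin (unit_space \<G>) A" "openin (unit_space \<G>) B"
    "x \<in> A" "act g x \<in> B" "A \<inter> B = {}"
    using Hausdorff_units[unfolded Hausdorff_space_def, rule_format, of x "act g x"]
      act_in_units[OF g(1)] topspace_unit_space unfolding disjnt_def by auto
  define U where "U = A \<inter> src \<G> ` (g \<inter> {a \<in> arrows \<G>. rng \<G> a \<in> B})"
  have "openin (gtop \<G>) {a \<in> arrows \<G>. rng \<G> a \<in> B}"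
    using openin_continuous_map_preimage[OF continuous_rng AB(2)] .
  then have "openin (gtop \<G>) (g \<inter> {a \<in> arrows \<G>. rng \<G> a \<in> B})"
    using bisection_openin[OF full_group_bisection[OF g(1)]] by blast
  then have "openin (unit_space \<G>) U" unfolding U_def using AB(1) open_src by blast
  moreover have "x \<in> U"
    using full_group_arrow[OF g(1) x(1)] AB unfolding U_def by (metis (mono_tags, lifting) IntI image_eqI mem_Collect_eq)
  moreover have "act g y \<notin> U" if "y \<in> U" for y
  proof -
    obtain a where "a \<in> g" "rng \<G> a \<in> B" "y = src \<G> a"
      using \<open>y \<in> U\<close> unfolding U_def by blast
    then have "act g y \<in> B" using act_src[OF g(1)] by metis
    then show ?thesis using AB(5) unfolding U_def by blast
  qed
  ultimately show ?thesis using that by blast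
qed

text \<open>Simplicity includes being non-trivial. Three arrows from one unit to distinct units
  thicken to a family, and its 3-cycle moves the first range to the second.\<close>

lemma alternating_nontrivial:
  assumes "units \<G> \<noteq> {}"
  shows "\<exists>g \<in> alternating_full_group \<G>. g \<noteq> units \<G>"
proof -
  obtain x where x: "x \<in> units \<G>" using assms by blast
  have "openin (unit_space \<G>) (units \<G>)" using topspace_unit_space by (metis openin_topspace)
  then obtain e :: "nat \<Rightarrow> 'a" where e: "\<And>n. e n \<in> arrows \<G> \<and> src \<G> (e n) = x \<and> rng \<G> (e n) \<in> units \<G> - {}"
    "inj (\<lambda>n. rng \<G> (e n))"
    using orbit_arrows[OF x _ assms finite.emptyI] by metis
  obtain C W where C: "clopen W" "x \<in> W" "bisection_family {0..<3} C W"
    "\<And>i. i \<in> {0..<3} \<Longrightarrow> e i \<in> C i \<and> C i \<subseteq> arrows \<G>"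
    by (rule family_around[of "{0..<3}" e "\<lambda>i. arrows \<G>" x])
      (use e in \<open>auto intro: inj_on_subset\<close>)
  obtain g where g: "g \<in> alternating_full_group \<G>" "realizes {0..<3} C (cycle3 0 1 2) g"
    by (rule three_cycle_exists[OF C(3), of 0 1 2]) auto
  have "act g (rng \<G> (e 0)) = rng \<G> (e 1)"
    by (rule realizes_moves[OF g(2), of 0]) (use C(4)[of 0] C(4)[of 1] e(1) in \<open>auto simp: cycle3_def\<close>)
  moreover have "rng \<G> (e 0) \<noteq> rng \<G> (e 1)" using e(2) by (auto dest: injD)
  ultimately have "g \<noteq> units \<G>" using act_units e(1)[of 0] by auto
  then show ?thesis using g by blast
qed

end

section \<open>Subgroups normalized by the alternating full group\<close>

locale normalized_subgroup = minimal_germ_groupoid +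
  fixes H :: "'a set set" and h :: "'a set" and U :: "'a set"
  assumes sub: "subgroup H (full_group \<G>)"
    and normalized: "normalized_by (full_group \<G>) H (alternating_full_group \<G>)"
    and h: "h \<in> H"
    and U: "openin (unit_space \<G>) U" "U \<noteq> {}"
    and displaced: "x \<in> U \<Longrightarrow> act h x \<notin> U"
begin

sublocale K: group "full_group \<G>" by (rule group_full_group)

lemma conj_closed:
  assumes "a \<in> alternating_full_group \<G>" "x \<in> H"
  shows "a \<otimes>\<^bsub>full_group \<G>\<^esub> x \<otimes>\<^bsub>full_group \<G>\<^esub> inv\<^bsub>full_group \<G>\<^esub> a \<in> H"
    and "inv\<^bsub>full_group \<G>\<^esub> a \<otimes>\<^bsub>full_group \<G>\<^esub> x \<otimes>\<^bsub>full_group \<G>\<^esub> a \<in> H"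
proof -
  show "a \<otimes>\<^bsub>full_group \<G>\<^esub> x \<otimes>\<^bsub>full_group \<G>\<^esub> inv\<^bsub>full_group \<G>\<^esub> a \<in> H"
    by (rule K.normalized_byD[OF normalized assms])
  have "inv\<^bsub>full_group \<G>\<^esub> (inv\<^bsub>full_group \<G>\<^esub> a) = a"
    using assms(1) alternating_subset by (intro K.inv_inv) blast
  then show "inv\<^bsub>full_group \<G>\<^esub> a \<otimes>\<^bsub>full_group \<G>\<^esub> x \<otimes>\<^bsub>full_group \<G>\<^esub> a \<in> H"
    using K.normalized_byD[OF normalized subgroup.m_inv_closed[OF alternating_subgroup assms(1)] assms(2)]
    by simp
qed

text \<open>The equation says \<open>t = a\<^sup>-\<^sup>1 b a b\<^sup>-\<^sup>1\<close>. As \<open>h a h\<^sup>-\<^sup>1\<close> commutes with \<open>b\<close>, this is the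
  commutator of \<open>c = a\<^sup>-\<^sup>1 h a h\<^sup>-\<^sup>1 \<in> H\<close> with \<open>b\<close>.\<close>

lemma commutator_in:
  assumes a: "a \<in> alternating_full_group \<G>" "\<And>x. x \<in> units \<G> - U \<Longrightarrow> act a x = x"
    and b: "b \<in> alternating_full_group \<G>" "\<And>x. x \<in> units \<G> - U \<Longrightarrow> act b x = x"
    and t: "t \<in> carrier (full_group \<G>)"
      "b \<otimes>\<^bsub>full_group \<G>\<^esub> a = a \<otimes>\<^bsub>full_group \<G>\<^esub> t \<otimes>\<^bsub>full_group \<G>\<^esub> b"
  shows "t \<in> H"
proof -
  let ?K = "full_group \<G>"
  have ac: "a \<in> carrier ?K" and bc: "b \<in> carrier ?K" and hc: "h \<in> carrier ?K"
    using a b h alternating_subset subgroup.subset[OF sub] by auto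
  define c where "c = inv\<^bsub>?K\<^esub> a \<otimes>\<^bsub>?K\<^esub> h \<otimes>\<^bsub>?K\<^esub> a \<otimes>\<^bsub>?K\<^esub> inv\<^bsub>?K\<^esub> h"
  define k where "k = h \<otimes>\<^bsub>?K\<^esub> a \<otimes>\<^bsub>?K\<^esub> inv\<^bsub>?K\<^esub> h"
  have cH: "c \<in> H" unfolding c_def
    using conj_closed(2)[OF a(1) h] subgroup.m_closed[OF sub] subgroup.m_inv_closed[OF sub h] by blast
  then have cc: "c \<in> carrier ?K" using subgroup.subset[OF sub] by blast
  have kc: "k \<in> carrier ?K" unfolding k_def using ac hc by simp
  have "a \<otimes>\<^bsub>?K\<^esub> c = a \<otimes>\<^bsub>?K\<^esub> (inv\<^bsub>?K\<^esub> a \<otimes>\<^bsub>?K\<^esub> k)"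
    unfolding c_def k_def using ac hc by (simp add: K.m_assoc)
  also have "\<dots> = k" using ac kc by (simp add: K.m_assoc[symmetric])
  finally have ack: "a \<otimes>\<^bsub>?K\<^esub> c = k" .
  \<comment> \<open>Conjugation by \<open>h\<close> pulls a unit of \<open>U\<close> back to a unit
    outside \<open>U\<close>, where \<open>a\<close> is trivial; hence \<open>k\<close> fixes
    \<open>U\<close>, and \<open>b\<close> fixes everything else.\<close>
  have bk: "b \<otimes>\<^bsub>?K\<^esub> k = k \<otimes>\<^bsub>?K\<^esub> b"
  proof (rule disjoint_support_commute[OF bc kc])
    fix x assume x: "x \<in> units \<G>"
    show "act b x = x \<or> act k x = x"
    proof (cases "x \<in> U")
      case True
      let ?y = "act (inv\<^bsub>?K\<^esub> h) x"
      have y: "?y \<in> units \<G>" "act h ?y = x" using act_in_units act_inv hc x by auto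
      have "?y \<notin> U" using displaced y(2) True by metis
      then have "act a ?y = ?y" using a(2) y(1) by blast
      then have "act k x = x" unfolding k_def using act_mult ac hc x y by simp
      then show ?thesis by simp
    next
      case False
      then show ?thesis using b(2) x by blast
    qed
  qed
  have "a \<otimes>\<^bsub>?K\<^esub> (t \<otimes>\<^bsub>?K\<^esub> b \<otimes>\<^bsub>?K\<^esub> c) = (a \<otimes>\<^bsub>?K\<^esub> t \<otimes>\<^bsub>?K\<^esub> b) \<otimes>\<^bsub>?K\<^esub> c"
    using ac bc cc t(1) by (simp add: K.m_assoc)
  also have "\<dots> = b \<otimes>\<^bsub>?K\<^esub> k" using ack t(2)[symmetric] ac bc cc by (simp add: K.m_assoc)
  also have "\<dots> = a \<otimes>\<^bsub>?K\<^esub> (c \<otimes>\<^bsub>?K\<^esub> b)" using bk ack[symmetric] ac bc cc by (simp add: K.m_assoc)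
  finally have tbc: "t \<otimes>\<^bsub>?K\<^esub> b \<otimes>\<^bsub>?K\<^esub> c = c \<otimes>\<^bsub>?K\<^esub> b"
    using ac bc cc t(1) by simp
  \<comment> \<open>Solving for \<open>t\<close> exhibits it as \<open>c\<close> times the conjugate
    by \<open>b\<close> of the inverse of \<open>c\<close>; the second factor is in \<open>H\<close>
    because \<open>b\<close> normalizes \<open>H\<close>.\<close>
  have "t = t \<otimes>\<^bsub>?K\<^esub> (b \<otimes>\<^bsub>?K\<^esub> c) \<otimes>\<^bsub>?K\<^esub> inv\<^bsub>?K\<^esub> (b \<otimes>\<^bsub>?K\<^esub> c)"
    using bc cc t(1) by (simp add: K.m_assoc)
  also have "\<dots> = c \<otimes>\<^bsub>?K\<^esub> b \<otimes>\<^bsub>?K\<^esub> inv\<^bsub>?K\<^esub> (b \<otimes>\<^bsub>?K\<^esub> c)"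
    using tbc bc cc t(1) by (simp add: K.m_assoc)
  also have "\<dots> = c \<otimes>\<^bsub>?K\<^esub> (b \<otimes>\<^bsub>?K\<^esub> inv\<^bsub>?K\<^esub> c \<otimes>\<^bsub>?K\<^esub> inv\<^bsub>?K\<^esub> b)"
    using bc cc by (simp add: K.m_assoc K.inv_mult_group)
  finally show ?thesis
    using cH conj_closed(1)[OF b(1) subgroup.m_inv_closed[OF sub cH]] subgroup.m_closed[OF sub] by metis
qed

text \<open>The indices 0, 1, 2 belong to the given 3-cycle, 3 to 7 to units in \<open>U\<close>.\<close>

lemma local_three_cycle:
  assumes B: "bisection_family {0, 1, 2::nat} B W" and x: "x \<in> W"
  obtains N where "clopen N" "x \<in> N" "N \<subseteq> W"
    "\<And>V g. \<lbrakk>clopen V; V \<subseteq> N; g \<in> carrier (full_group \<G>);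
       realizes {0, 1, 2} (\<lambda>i. restrict_src (B i) V) (cycle3 0 1 2) g\<rbrakk> \<Longrightarrow> g \<in> H"
proof -
  let ?K = "full_group \<G>"
  let ?I = "{0..<8::nat}"
  have xu: "x \<in> units \<G>"
    using x bisection_family_clopen[OF B, of 0] clopen_subset by auto
  have "\<exists>b. b \<in> B i \<and> src \<G> b = x" if "i \<in> {0, 1, 2}" for i
    using bisection_familyD(2)[OF B that] x by blast
  then obtain b where b: "\<And>i. i \<in> {0, 1, 2} \<Longrightarrow> b i \<in> B i \<and> src \<G> (b i) = x" by metis
  let ?P = "(\<lambda>i. rng \<G> (b i)) ` {0, 1, 2}"
  obtain e :: "nat \<Rightarrow> 'a" where e: "\<And>n. e n \<in> arrows \<G> \<and> src \<G> (e n) = x \<and> rng \<G> (e n) \<in> U - ?P"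
    "inj (\<lambda>n. rng \<G> (e n))"
    by (rule orbit_arrows[OF xu U, of ?P]) auto
  define c where "c i = (if i < 3 then b i else e i)" for i
  \<comment> \<open>Staying inside \<open>S i\<close> makes the first three bisections shrink the
    given ones and keeps the ranges of the others within \<open>U\<close>.\<close>
  define S where "S i = (if i < 3 then B i else {a \<in> arrows \<G>. rng \<G> a \<in> U})" for i
  have lt3: "i < 3 \<longleftrightarrow> i \<in> {0, 1, 2}" for i :: nat by auto
  have opU: "openin (gtop \<G>) {a \<in> arrows \<G>. rng \<G> a \<in> U}"
    using openin_continuous_map_preimage[OF continuous_rng U(1)] .
  have cS: "c i \<in> S i \<and> openin (gtop \<G>) (S i) \<and> src \<G> (c i) = x" for i
  proof (cases "i < 3")
    case True
    then have i: "i \<in> {0, 1, 2}" using lt3 by blast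
    show ?thesis
      using True b[OF i] bisection_openin[OF bisection_familyD(1)[OF B i]] unfolding c_def S_def by simp
  next
    case False
    then show ?thesis using e(1)[of i] opU unfolding c_def S_def by simp
  qed
  have inj: "inj_on (\<lambda>i. rng \<G> (c i)) ?I"
  proof (rule inj_onI)
    fix i j assume eq: "rng \<G> (c i) = rng \<G> (c j)"
    consider "i < 3" "j < 3" | "\<not> i < 3" "\<not> j < 3" | "i < 3" "\<not> j < 3" | "\<not> i < 3" "j < 3" by blast
    then show "i = j"
    proof cases
      case 1
      then show ?thesis
        using eq bisection_family_disjoint[OF B, of i j "b i" "b j"] b unfolding c_def lt3 by simp
    next
      case 2
      then show ?thesis using eq injD[OF e(2)] unfolding c_def by simp
    next
      case 3
      then have "rng \<G> (e j) \<in> ?P" using eq[symmetric] unfolding c_def lt3 by auto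
      then show ?thesis using e(1) by blast
    next
      case 4
      then have "rng \<G> (e i) \<in> ?P" using eq unfolding c_def lt3 by auto
      then show ?thesis using e(1) by blast
    qed
  qed
  obtain C N where N: "clopen N" "x \<in> N" and C: "bisection_family ?I C N"
    and CS: "\<And>i. i \<in> ?I \<Longrightarrow> c i \<in> C i \<and> C i \<subseteq> S i"
    by (rule family_around[of ?I c S x, OF _ _ cS inj]) auto
  have CB: "C i \<subseteq> B i" if "i \<in> {0, 1, 2}" for i using CS[of i] that unfolding S_def by auto
  have CU: "rng \<G> ` C i \<subseteq> U" if "i \<in> ?I" "\<not> i < 3" for i using CS[of i] that unfolding S_def by auto
  have NW: "N \<subseteq> W"
    using bisection_familyD(2)[OF C, of 0] bisection_familyD(2)[OF B, of 0] CB[of 0] by auto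
  have "g \<in> H" if V: "clopen V" "V \<subseteq> N" and gc: "g \<in> carrier ?K"
    and g: "realizes {0, 1, 2} (\<lambda>i. restrict_src (B i) V) (cycle3 0 1 2) g" for V g
  proof -
    define D where "D i = restrict_src (C i) V" for i
    have D: "bisection_family ?I D V"
      unfolding D_def by (rule bisection_family_restrict[OF C V])
    \<comment> \<open>Both sides have source set \<open>V\<close> and \<open>src\<close> is
      injective on \<open>B i\<close>, so the inclusion is an equality. Hence \<open>g\<close> is a
      3-cycle of the larger family \<open>D\<close> too.\<close>
    have "D i = restrict_src (B i) V" if i: "i \<in> {0, 1, 2}" for i
    proof (intro equalityI subsetI)
      show "a \<in> restrict_src (B i) V" if "a \<in> D i" for a
        using that CB[OF i] unfolding D_def restrict_src_def by blast
      fix a assume a: "a \<in> restrict_src (B i) V"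
      have "i \<in> ?I" using i by auto
      then have "src \<G> a \<in> src \<G> ` C i"
        using a V(2) bisection_familyD(2)[OF C] unfolding restrict_src_def by blast
      then obtain d where d: "d \<in> C i" "src \<G> a = src \<G> d" by blast
      then have "a = d"
        using inj_onD[OF bisection_inj_src[OF bisection_familyD(1)[OF B i]] d(2)] a CB[OF i]
        unfolding restrict_src_def by blast
      then show "a \<in> D i" using a d(1) unfolding D_def restrict_src_def by blast
    qed
    then have "realizes {0, 1, 2} D (cycle3 0 1 2) g"
      by (intro realizes_cong[OF g]) (auto simp: cycle3_def)
    then have rg: "realizes ?I D (cycle3 0 1 2) g"
      by (rule realizes_extend[OF _ D]) (auto simp: cycle3_def)
    \<comment> \<open>Exchanging 0 with 5, 1 with 4 and 2 with 6 would carry the given cycle into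
      \<open>U\<close>, but such exchanges are odd. The spare index 7, which \<open>t\<close> fixes,
      makes 3-cycles of them.\<close>
    obtain g1 where g1: "g1 \<in> alternating_full_group \<G>" "realizes ?I D (cycle3 0 5 7) g1"
      by (rule three_cycle_exists[OF D, of 0 5 7]) auto
    obtain g2 where g2: "g2 \<in> alternating_full_group \<G>" "realizes ?I D (cycle3 1 4 7) g2"
      by (rule three_cycle_exists[OF D, of 1 4 7]) auto
    obtain g3 where g3: "g3 \<in> alternating_full_group \<G>" "realizes ?I D (cycle3 2 6 7) g3"
      by (rule three_cycle_exists[OF D, of 2 6 7]) auto
    obtain t where t: "t \<in> alternating_full_group \<G>" "realizes ?I D (cycle3 5 4 6) t"
      by (rule three_cycle_exists[OF D, of 5 4 6]) auto
    \<comment> \<open>The cycles of \<open>a\<close> and \<open>b\<close> overlap in the index 5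
      alone, which makes \<open>a\<^sup>-\<^sup>1 b a b\<^sup>-\<^sup>1\<close> the cycle 5, 4, 6 of
      \<open>t\<close>.\<close>
    obtain a where a: "a \<in> alternating_full_group \<G>" "realizes ?I D (cycle3 3 4 5) a"
      by (rule three_cycle_exists[OF D, of 3 4 5]) auto
    obtain b where b: "b \<in> alternating_full_group \<G>" "realizes ?I D (cycle3 5 6 7) b"
      by (rule three_cycle_exists[OF D, of 5 6 7]) auto
    have car: "g1 \<in> carrier ?K" "g2 \<in> carrier ?K" "g3 \<in> carrier ?K" "t \<in> carrier ?K"
      "a \<in> carrier ?K" "b \<in> carrier ?K"
      using g1 g2 g3 t a b alternating_subset by auto
    \<comment> \<open>A unit outside \<open>U\<close> lies over an index below 3, which
      \<open>\<sigma>\<close> fixes, or over no index at all.\<close>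
    have supp: "act f z = z" if f: "realizes ?I D \<sigma> f" and \<sigma>: "\<And>i. i < 3 \<Longrightarrow> \<sigma> i = i"
      and z: "z \<in> units \<G> - U" for f \<sigma> z
    proof (cases "\<exists>i\<in>?I. z \<in> rng \<G> ` D i")
      case True
      then obtain i d where i: "i \<in> ?I" "d \<in> D i" "z = rng \<G> d" by blast
      then have "i < 3" using CU[of i] z restrict_src_subset unfolding D_def by blast
      then show ?thesis using realizes_fixes_index[OF f i(1) \<sigma> i(2)] i(3) by simp
    next
      case False
      then show ?thesis using realizes_fixes[OF f] z by blast
    qed
    have m: "realizes ?I D (\<sigma> \<circ> cycle3 i j k) (f \<otimes>\<^bsub>?K\<^esub> f')"
      if "f \<in> carrier ?K" "f' \<in> carrier ?K" "realizes ?I D \<sigma> f" "realizes ?I D (cycle3 i j k) f'"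
        "i \<in> ?I" "j \<in> ?I" "k \<in> ?I" for \<sigma> i j k f f'
      by (rule realizes_mult[OF D that(1-4) cycle3_closed[OF that(5-7)]])
    have I8: "?I = {0, 1, 2, 3, 4, 5, 6, 7}" by auto
    have eq_if: "f = f'" if "f \<in> carrier ?K" "f' \<in> carrier ?K" "realizes ?I D \<sigma> f" "realizes ?I D \<sigma>' f'"
      "\<forall>i\<in>?I. \<sigma> i \<in> ?I \<and> \<sigma> i = \<sigma>' i" for f f' \<sigma> \<sigma>'
      by (rule realizes_unique[OF D that(1-4)]) (use that(5) in blast)+
    have ba: "b \<otimes>\<^bsub>?K\<^esub> a = a \<otimes>\<^bsub>?K\<^esub> t \<otimes>\<^bsub>?K\<^esub> b"
    proof (rule eq_if)
      show "realizes ?I D (cycle3 5 6 7 \<circ> cycle3 3 4 5) (b \<otimes>\<^bsub>?K\<^esub> a)"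
        using a b car by (intro m) auto
      show "realizes ?I D (cycle3 3 4 5 \<circ> cycle3 5 4 6 \<circ> cycle3 5 6 7) (a \<otimes>\<^bsub>?K\<^esub> t \<otimes>\<^bsub>?K\<^esub> b)"
        using a b t car by (intro m) auto
      show "\<forall>i\<in>?I. (cycle3 5 6 7 \<circ> cycle3 3 4 5) i \<in> ?I \<and>
          (cycle3 5 6 7 \<circ> cycle3 3 4 5) i = (cycle3 3 4 5 \<circ> cycle3 5 4 6 \<circ> cycle3 5 6 7) i"
        by (simp only: I8 ball_simps) (simp add: cycle3_def)
    qed (use car in simp_all)
    have tH: "t \<in> H"
      by (rule commutator_in[OF a(1) _ b(1) _ car(4) ba])
        (rule supp[OF a(2)] supp[OF b(2)]; simp add: cycle3_def)+
    \<comment> \<open>On indices \<open>w\<close> sends 0, 1, 2 to 5, 4, 6, the cyclic order of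
      \<open>t\<close>, so that \<open>w\<close> conjugates \<open>g\<close> to
      \<open>t\<close>.\<close>
    define w where "w = g3 \<otimes>\<^bsub>?K\<^esub> g2 \<otimes>\<^bsub>?K\<^esub> g1"
    have wA: "w \<in> alternating_full_group \<G>" unfolding w_def
      using g1 g2 g3 subgroup.m_closed[OF alternating_subgroup] by blast
    then have wc: "w \<in> carrier ?K" using alternating_subset by blast
    have rw: "realizes ?I D (cycle3 2 6 7 \<circ> cycle3 1 4 7 \<circ> cycle3 0 5 7) w"
      unfolding w_def using g1 g2 g3 car by (intro m) auto
    have "w \<otimes>\<^bsub>?K\<^esub> g = t \<otimes>\<^bsub>?K\<^esub> w"
    proof (rule eq_if)
      show "realizes ?I D (cycle3 2 6 7 \<circ> cycle3 1 4 7 \<circ> cycle3 0 5 7 \<circ> cycle3 0 1 2) (w \<otimes>\<^bsub>?K\<^esub> g)"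
        using rw rg wc gc by (intro m) auto
      show "realizes ?I D (cycle3 5 4 6 \<circ> (cycle3 2 6 7 \<circ> cycle3 1 4 7 \<circ> cycle3 0 5 7)) (t \<otimes>\<^bsub>?K\<^esub> w)"
        by (rule realizes_mult[OF D car(4) wc t(2) rw], simp only: I8 image_insert image_empty)
          (simp add: cycle3_def)
      show "\<forall>i\<in>?I. (cycle3 2 6 7 \<circ> cycle3 1 4 7 \<circ> cycle3 0 5 7 \<circ> cycle3 0 1 2) i \<in> ?I \<and>
          (cycle3 2 6 7 \<circ> cycle3 1 4 7 \<circ> cycle3 0 5 7 \<circ> cycle3 0 1 2) i =
          (cycle3 5 4 6 \<circ> (cycle3 2 6 7 \<circ> cycle3 1 4 7 \<circ> cycle3 0 5 7)) i"
        by (simp only: I8 ball_simps) (simp add: cycle3_def)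
    qed (use car wc gc in simp_all)
    then have "inv\<^bsub>?K\<^esub> w \<otimes>\<^bsub>?K\<^esub> (w \<otimes>\<^bsub>?K\<^esub> g) = inv\<^bsub>?K\<^esub> w \<otimes>\<^bsub>?K\<^esub> (t \<otimes>\<^bsub>?K\<^esub> w)"
      by (rule arg_cong)
    also have "\<dots> = inv\<^bsub>?K\<^esub> w \<otimes>\<^bsub>?K\<^esub> t \<otimes>\<^bsub>?K\<^esub> w"
      using wc car(4) by (simp add: K.m_assoc)
    finally have "inv\<^bsub>?K\<^esub> w \<otimes>\<^bsub>?K\<^esub> t \<otimes>\<^bsub>?K\<^esub> w = inv\<^bsub>?K\<^esub> w \<otimes>\<^bsub>?K\<^esub> (w \<otimes>\<^bsub>?K\<^esub> g)"
      by (rule sym)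
    also have "\<dots> = g" using wc gc by (simp add: K.m_assoc[symmetric])
    finally show ?thesis using conj_closed(2)[OF wA tH] by simp
  qed
  then show ?thesis using that[OF N NW] by metis
qed

lemma three_cycle_in:
  assumes B: "bisection_family {0, 1, 2::nat} B W" and g: "g \<in> carrier (full_group \<G>)"
    "realizes {0, 1, 2} B (cycle3 0 1 2) g"
  shows "g \<in> H"
proof -
  let ?K = "full_group \<G>"
  \<comment> \<open>Quantifying over every clopen \<open>V\<close> inside \<open>S\<close> makes the
    property stable under finite unions; for a fixed \<open>V\<close> the pieces cut off by the
    cover would not be accounted for.\<close>
  define good where "good S \<longleftrightarrow> clopen S \<and> S \<subseteq> W \<and> (\<forall>V g. clopen V \<and> V \<subseteq> S \<and> g \<in> carrier ?K \<and>
      realizes {0, 1, 2} (\<lambda>i. restrict_src (B i) V) (cycle3 0 1 2) g \<longrightarrow> g \<in> H)" for S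
  have goodD: "g \<in> H" if "good S" "clopen V" "V \<subseteq> S" "g \<in> carrier ?K"
    "realizes {0, 1, 2} (\<lambda>i. restrict_src (B i) V) (cycle3 0 1 2) g" for S V g
    using that unfolding good_def by meson
  have "\<exists>N. x \<in> N \<and> good N" if "x \<in> W" for x
    using local_three_cycle[OF B that] unfolding good_def by metis
  then obtain N where N: "\<And>x. x \<in> W \<Longrightarrow> x \<in> N x \<and> good (N x)" by metis
  have W: "clopen W" by (rule bisection_family_clopen[OF B, of 0]) simp
  have "compactin (unit_space \<G>) W"
    using W closedin_compact_space[OF compact_units] unfolding clopen_def by blast
  moreover have "\<And>S. S \<in> N ` W \<Longrightarrow> openin (unit_space \<G>) S" "W \<subseteq> \<Union> (N ` W)"
    using N unfolding good_def clopen_def by auto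
  ultimately obtain \<F> where \<F>: "finite \<F>" "\<F> \<subseteq> N ` W" "W \<subseteq> \<Union> \<F>"
    using compactinD by metis
  have "good (\<Union> \<F>)" if "finite \<F>" "\<And>S. S \<in> \<F> \<Longrightarrow> good S" for \<F>
    using that
  proof (induction \<F> rule: finite_induct)
    case empty
    \<comment> \<open>Over the empty set nothing is moved, and effectiveness makes \<open>g\<close>
      the identity.\<close>
    have "g \<in> H" if "g \<in> carrier ?K" "realizes {0, 1, 2} (\<lambda>i. restrict_src (B i) {}) (cycle3 0 1 2) g" for g
    proof -
      have "act g x = x" if "x \<in> units \<G>" for x
        by (rule realizes_fixes[OF \<open>realizes _ _ _ g\<close> that]) (simp add: restrict_src_def)
      then have "g = \<one>\<^bsub>?K\<^esub>" using full_group_trivial that(1) full_group_one by simp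
      then show ?thesis using subgroup.one_closed[OF sub] by simp
    qed
    moreover have "clopen {}" unfolding clopen_def by simp
    ultimately show ?case unfolding good_def by simp
  next
    case (insert S \<F>)
    then have S: "good S" and T: "good (\<Union> \<F>)" by auto
    have "g \<in> H" if V: "clopen V" "V \<subseteq> S \<union> \<Union> \<F>" and g: "g \<in> carrier ?K"
      "realizes {0, 1, 2} (\<lambda>i. restrict_src (B i) V) (cycle3 0 1 2) g" for V g
    proof -
      let ?V1 = "V \<inter> S" and ?V2 = "V - S"
      have ST: "clopen S" "S \<subseteq> W" "\<Union> \<F> \<subseteq> W" using S T by (auto simp only: good_def)
      have cl: "clopen ?V1" "clopen ?V2" by (rule clopen_Int clopen_Diff, rule V(1), rule ST(1))+
      have VW: "V \<subseteq> W" using V(2) ST by blast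
      have fam: "bisection_family {0, 1, 2} (\<lambda>i. restrict_src (B i) ?V1) ?V1"
        "bisection_family {0, 1, 2} (\<lambda>i. restrict_src (B i) ?V2) ?V2"
        "bisection_family {0, 1, 2} (\<lambda>i. restrict_src (B i) V) V"
        by (rule bisection_family_restrict[OF B]; use cl V VW in blast)+
      obtain g1 where g1: "g1 \<in> alternating_full_group \<G>"
        "realizes {0, 1, 2} (\<lambda>i. restrict_src (B i) ?V1) (cycle3 0 1 2) g1"
        by (rule three_cycle_exists[OF fam(1), of 0 1 2]) auto
      obtain g2 where g2: "g2 \<in> alternating_full_group \<G>"
        "realizes {0, 1, 2} (\<lambda>i. restrict_src (B i) ?V2) (cycle3 0 1 2) g2"
        by (rule three_cycle_exists[OF fam(2), of 0 1 2]) auto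
      have car: "g1 \<in> carrier ?K" "g2 \<in> carrier ?K" using g1 g2 alternating_subset by auto
      have "?V1 \<subseteq> S" "?V2 \<subseteq> \<Union> \<F>" using V(2) by blast+
      then have "g1 \<in> H" "g2 \<in> H" using goodD[OF S cl(1) _ car(1) g1(2)] goodD[OF T cl(2) _ car(2) g2(2)] by simp_all
      \<comment> \<open>No factorization of \<open>g\<close> is given; uniqueness identifies it with
        the product of the 3-cycles built over the two pieces.\<close>
      have "g = g1 \<otimes>\<^bsub>?K\<^esub> g2"
      proof (rule realizes_unique[OF fam(3) g(1) _ g(2)])
        have "realizes {0, 1, 2} (\<lambda>i. restrict_src (B i) (?V1 \<union> ?V2)) (cycle3 0 1 2) (g1 \<otimes>\<^bsub>?K\<^esub> g2)"
          by (rule realizes_split[OF B _ car g1(2) g2(2)]) (auto simp: cycle3_def)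
        then show "realizes {0, 1, 2} (\<lambda>i. restrict_src (B i) V) (cycle3 0 1 2) (g1 \<otimes>\<^bsub>?K\<^esub> g2)"
          by (simp add: Int_Diff_Un)
      qed (use car in \<open>auto simp: cycle3_def\<close>)
      then show ?thesis using subgroup.m_closed[OF sub \<open>g1 \<in> H\<close> \<open>g2 \<in> H\<close>] by simp
    qed
    moreover have "clopen (S \<union> \<Union> \<F>)" "S \<union> \<Union> \<F> \<subseteq> W" using S T clopen_Un unfolding good_def by auto
    ultimately show ?case unfolding good_def Union_insert by blast
  qed
  then have "good (\<Union> \<F>)" using \<F>(1,2) N by blast
  moreover have "realizes {0, 1, 2} (\<lambda>i. restrict_src (B i) W) (cycle3 0 1 2) g"
  proof (rule realizes_cong[OF g(2)])
    show "restrict_src (B i) W = B i" if "i \<in> {0, 1, 2}" for i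
      using bisection_familyD(2)[OF B that] unfolding restrict_src_def by auto
  qed (auto simp: cycle3_def)
  ultimately show ?thesis by (rule goodD[OF _ W \<F>(3) g(1)])
qed

text \<open>Only generators need checking. An even permutation of three indices is the identity or a
  rotation, and a rotation becomes \<open>cycle3 0 1 2\<close> once the indices are listed in the
  order in which it runs.\<close>

lemma alternating_contained: "alternating_full_group \<G> \<subseteq> H"
  unfolding alternating_full_group_def
proof (rule K.generate_subgroup_incl[OF _ sub], rule subsetI)
  fix g assume "g \<in> (\<Union>F \<in> {F. multisection \<G> 3 F}. multisection_alt \<G> 3 F)"
  then obtain F \<pi> where F: "multisection \<G> 3 F" and \<pi>: "\<pi> permutes {1..3}" "evenperm \<pi>"
    and g: "g = multisection_perm \<G> 3 F \<pi>"
    unfolding multisection_alt_def by blast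
  have gc: "g \<in> carrier (full_group \<G>)" unfolding g by (rule multisection_perm_closed[OF F \<pi>(1)])
  have r: "realizes {1..3} (F 1) \<pi> g"
    unfolding g by (rule realizes_multisection_perm[OF F _ \<pi>(1)]) simp
  have fam: "bisection_family {1..3} (F 1) (F 1 1)" by (rule multisection_family[OF F]) simp
  have three: "g \<in> H" if p: "p ` {0, 1, 2} = {1..3}" "inj_on p {0, 1, 2}"
    "\<And>i. i \<in> {0, 1, 2} \<Longrightarrow> \<pi> (p i) = p (cycle3 0 1 2 i)" for p :: "nat \<Rightarrow> nat"
  proof (rule three_cycle_in[OF _ gc])
    show "bisection_family {0, 1, 2} (\<lambda>i. F 1 (p i)) (F 1 1)"
      by (rule bisection_family_reindex[OF _ p(2)]) (use p(1) fam in simp)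
    show "realizes {0, 1, 2} (\<lambda>i. F 1 (p i)) (cycle3 0 1 2) g"
      by (rule realizes_reindex[of p "{0, 1, 2}" "F 1" \<pi> g]) (use p(1,3) r in simp_all)
  qed
  consider "\<pi> = id" | "\<pi> = cycle3 1 2 3" | "\<pi> = cycle3 1 3 2" using evenperm_3_cases[OF \<pi>] by blast
  then show "g \<in> H"
  proof cases
    case 1
    have "F i i \<subseteq> units \<G>" if "i \<in> {1..3}" for i using F that unfolding multisection_def by blast
    then have "g = units \<G>" unfolding g 1 multisection_perm_def id_apply by blast
    then show ?thesis using subgroup.one_closed[OF sub] full_group_one by simp
  next
    case 2
    show ?thesis by (rule three[of Suc]) (auto simp: 2 cycle3_def)
  next
    case 3
    \<comment> \<open>The relabelling lists 1, 3, 2, the order of this cycle.\<close>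
    show ?thesis
      by (rule three[of "\<lambda>i. if i = 0 then 1 else if i = 1 then 3 else 2"])
        (auto simp: 3 cycle3_def inj_on_def)
  qed
qed

end

section \<open>Arbitrary normalized subgroups, and the Cantor set\<close>

lemma (in minimal_germ_groupoid) alternating_subset_normalized:
  assumes H: "subgroup H (full_group \<G>)" "H \<noteq> {\<one>\<^bsub>full_group \<G>\<^esub>}"
    "normalized_by (full_group \<G>) H (alternating_full_group \<G>)"
  shows "alternating_full_group \<G> \<subseteq> H"
proof -
  obtain h where h: "h \<in> H" "h \<noteq> units \<G>"
    using H(2) subgroup.one_closed[OF H(1)] full_group_one by auto
  then have "h \<in> carrier (full_group \<G>)" using subgroup.subset[OF H(1)] by blast
  then obtain U where U: "openin (unit_space \<G>) U" "U \<noteq> {}" "\<And>x. x \<in> U \<Longrightarrow> act h x \<notin> U"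
    using displaced_open_set h(2) by metis
  interpret normalized_subgroup \<G> H h U
    by (intro normalized_subgroup.intro normalized_subgroup_axioms.intro
        minimal_germ_groupoid_axioms H h U)
  show ?thesis by (rule alternating_contained)
qed

text \<open>Flipping the \<open>n\<close>-th bit of \<open>z\<close> gives points other than
  \<open>z\<close> that converge to \<open>z\<close>, because each coordinate is changed for one
  \<open>n\<close> only.\<close>

lemma cantor_space_perfect: "\<not> openin cantor_space {z}"
proof
  assume op: "openin cantor_space {z}"
  have "limitin cantor_space (\<lambda>n. z(n := \<not> z n)) z sequentially"
    unfolding cantor_space_def limitin_componentwise
  proof (intro conjI ballI)
    fix k
    have "eventually (\<lambda>n. (z(n := \<not> z n)) k = z k) sequentially"
      using eventually_gt_at_top[of k] by eventually_elim auto
    then show "limitin (discrete_topology UNIV) (\<lambda>n. (z(n := \<not> z n)) k) (z k) sequentially"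
      unfolding limitin_def by (auto elim: eventually_mono)
  qed auto
  then have "eventually (\<lambda>n. z(n := \<not> z n) \<in> {z}) sequentially"
    using op unfolding limitin_def by blast
  then obtain n where "z(n := \<not> z n) = z" unfolding eventually_sequentially by auto
  then show False by (metis fun_upd_same)
qed

theorem theorem4p1:
  fixes \<G> :: "'a top_groupoid"
  assumes "etale_groupoid \<G>"
    and "unit_space \<G> homeomorphic_space cantor_space"
    and "minimal_groupoid \<G>"
    and "groupoid_of_germs \<G>"
  shows "(\<forall>H. subgroup H (full_group \<G>) \<and> H \<noteq> {\<one>\<^bsub>full_group \<G>\<^esub>} \<and>
              normalized_by (full_group \<G>) H (alternating_full_group \<G>)
              \<longrightarrow> alternating_full_group \<G> \<subseteq> H) \<and>
         is_simple_group (full_group \<G>\<lparr>carrier := alternating_full_group \<G>\<rparr>) \<and>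
         (\<forall>N. N \<lhd> full_group \<G> \<and> N \<noteq> {\<one>\<^bsub>full_group \<G>\<^esub>}
              \<longrightarrow> alternating_full_group \<G> \<subseteq> N)"
proof -
  interpret etale_groupoid \<G> by (rule assms(1))
  obtain f f' where f: "homeomorphic_maps (unit_space \<G>) cantor_space f f'"
    using assms(2) unfolding homeomorphic_space_def by blast
  then have hf: "homeomorphic_map (unit_space \<G>) cantor_space f"
    unfolding homeomorphic_map_maps by blast
  have comp: "compact_space (unit_space \<G>)"
    using homeomorphic_compact_space[OF assms(2)]
    by (simp add: cantor_space_def compact_space_product_topology compact_space_discrete_topology)
  have haus: "Hausdorff_space (unit_space \<G>)"
    using homeomorphic_Hausdorff_space[OF assms(2)]
    by (simp add: cantor_space_def Hausdorff_space_product_topology)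
  have perf: "\<not> openin (unit_space \<G>) {x}" if "x \<in> units \<G>" for x
  proof -
    have "{x} \<subseteq> topspace (unit_space \<G>)" unfolding topspace_unit_space using that by simp
    from homeomorphic_map_openness[OF hf this] show ?thesis
      using cantor_space_perfect[of "f x"] by (metis image_empty image_insert)
  qed
  have ne: "units \<G> \<noteq> {}"
  proof
    assume "units \<G> = {}"
    then have "topspace cantor_space = {}"
      using homeomorphic_imp_surjective_map[OF hf] topspace_unit_space by simp
    moreover have "(\<lambda>_. True) \<in> topspace cantor_space"
      unfolding cantor_space_def topspace_product_topology by simp
    ultimately show False by blast
  qed
  interpret minimal_germ_groupoid \<G>
    by unfold_locales (use comp haus perf assms in auto)
  interpret K: group "full_group \<G>" by (rule group_full_group)
  let ?K = "full_group \<G>" and ?A = "alternating_full_group \<G>"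
  let ?L = "?K\<lparr>carrier := ?A\<rparr>"
  note A = alternating_subgroup
  have L: "group ?L" by (rule subgroup.subgroup_is_group[OF A group_full_group])
  \<comment> \<open>A normal subgroup of the alternating full group is a subgroup of the full group
    normalized by it, so the containment result applies and leaves no proper non-trivial
    choice.\<close>
  have "N = {\<one>\<^bsub>?L\<^esub>} \<or> N = carrier ?L" if N: "N \<lhd> ?L" for N
  proof -
    have sL: "subgroup N ?L" by (rule normal_imp_subgroup[OF N])
    then have NA: "N \<subseteq> ?A" using subgroup.subset by force
    have s: "subgroup N ?K" by (rule K.incl_subgroup[OF A sL])
    have "normalized_by ?K N ?A"
    proof (rule K.normalized_byI[OF A s])
      fix a x assume "a \<in> ?A" "x \<in> N"
      then show "a \<otimes>\<^bsub>?K\<^esub> x \<otimes>\<^bsub>?K\<^esub> inv\<^bsub>?K\<^esub> a \<in> N"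
        using normal.inv_op_closed2[OF N, of a x] K.m_inv_consistent[OF A] by simp
    qed
    then show ?thesis using alternating_subset_normalized[OF s] NA by auto
  qed
  moreover have "carrier ?L \<noteq> {\<one>\<^bsub>?L\<^esub>}"
    using alternating_nontrivial[OF ne] full_group_one by auto
  ultimately have simple: "is_simple_group ?L" unfolding is_simple_group_def using L by blast
  have "?A \<subseteq> N" if N: "N \<lhd> ?K" "N \<noteq> {\<one>\<^bsub>?K\<^esub>}" for N
  proof (rule alternating_subset_normalized[OF normal_imp_subgroup[OF N(1)] N(2)])
    show "normalized_by ?K N ?A"
      by (rule K.normalized_byI[OF A normal_imp_subgroup[OF N(1)]])
        (use normal.inv_op_closed2[OF N(1)] alternating_subset in blast)
  qed
  then show ?thesis using simple alternating_subset_normalized by blast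
qed

end
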